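(* Let $v>0$ and let $(X_t)_{t\ge1}$ be random vectors in $\mathbb{R}^d$ with $\mathbb{E}[X_t\mid\mathcal{F}_{t-1}]=\mu$ and $\mathbb{E}[\|X_t\|^2\mid\mathcal{F}_{t-1}]\le v^2<\infty$ for all $t\ge1$. Let $\Sigma_t=\mathrm{Cov}(X_t\mid\mathcal{F}_{t-1})$ and let $(\lambda_t)_{t\ge1}$ be a predictable sequence in $(0,\infty)$. For any $\beta>0$, vector $x\in\mathbb{R}^d$ and matrix $A\in\mathbb{R}^{d\times d}$, set $$s_\beta(x)=\left(1+\frac1\beta\right)(\|x\|+v)^2,\qquad w_\beta(A)=\|A\|+\frac{\mathrm{Tr}(A)}{\beta}.$$ Then, for any $\beta>0$ and $\alpha\in(0,1)$, with probability at least $1-\alpha$, for all $t\geq 1$ simultaneously, $$\left\|\frac{\sum_{i\leq t}\lambda_iX_i}{\sum_{i\leq t}\lambda_i}-\mu\right\|\leq\frac{\sum_{i\leq t}\lambda_i^2\{s_\beta(X_i)+2w_\beta(\Sigma_i)\}}{6\sum_{i\leq t}\lambda_i}+\frac{\beta/2+\log(1/\alpha)}{\sum_{i\leq t}\lambda_i}.$$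
   Context: $\mathcal{F}_t=\sigma(X_1,\dots,X_t)$ ($\mathcal{F}_0$ trivial); $(\lambda_t)$ is predictable if $\lambda_t$ is $\mathcal{F}_{t-1}$-measurable for every $t$. $\|\cdot\|$ is the Euclidean norm for vectors and the operator norm for matrices. $\mathrm{Cov}(X_t\mid\mathcal{F}_{t-1})=\mathbb{E}[(X_t-\mu)(X_t-\mu)^\top\mid\mathcal{F}_{t-1}]$. *)

theory Defs
  imports "HOL-Probability.Probability"
begin

(* The sigma-algebra generated by X 1, ..., X t on space M. The explicit use of space M
   makes the case t = 0 the trivial sigma-algebra {{}, space M}; a supremum of
   vimage_algebra over the empty index set would have the wrong space. *)
definition nat_filt ::
  "'w measure \<Rightarrow> (nat \<Rightarrow> 'w \<Rightarrow> 'b::topological_space) \<Rightarrow> nat \<Rightarrow> 'w measure" where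
  "nat_filt M X t =
     sigma (space M) (\<Union>i\<in>{1..t}. {X i -` B \<inter> space M | B. B \<in> sets borel})"

lemma space_nat_filt [simp]: "space (nat_filt M X t) = space M"
  by (simp add: nat_filt_def space_measure_of_conv)

lemma sets_nat_filt_0: "sets (nat_filt M X 0) = {{}, space M}"
  by (simp add: nat_filt_def sigma_sets_empty_eq)

(* Conditional expectations of random vectors and matrices are taken entrywise, since
   real_cond_exp is real-valued. *)
definition vec_cond_exp ::
  "'w measure \<Rightarrow> 'w measure \<Rightarrow> ('w \<Rightarrow> real ^ 'd) \<Rightarrow> 'w \<Rightarrow> real ^ 'd" where
  "vec_cond_exp M F Y \<omega> = (\<chi> i. real_cond_exp M F (\<lambda>\<omega>'. Y \<omega>' $ i) \<omega>)"

definition mat_cond_exp ::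
  "'w measure \<Rightarrow> 'w measure \<Rightarrow> ('w \<Rightarrow> real ^ 'n ^ 'm) \<Rightarrow> 'w \<Rightarrow> real ^ 'n ^ 'm" where
  "mat_cond_exp M F Y \<omega> = (\<chi> i j. real_cond_exp M F (\<lambda>\<omega>'. Y \<omega>' $ i $ j) \<omega>)"

definition outer_prod :: "real ^ 'm \<Rightarrow> real ^ 'n \<Rightarrow> real ^ 'n ^ 'm" where
  "outer_prod x y = (\<chi> i j. x $ i * y $ j)"

(* Centred at a given vector \<mu>, which is the conditional mean of Y wherever this is used. *)
definition cond_cov ::
  "'w measure \<Rightarrow> 'w measure \<Rightarrow> ('w \<Rightarrow> real ^ 'd) \<Rightarrow> real ^ 'd \<Rightarrow> 'w \<Rightarrow> real ^ 'd ^ 'd" where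
  "cond_cov M F Y \<mu> = mat_cond_exp M F (\<lambda>\<omega>. outer_prod (Y \<omega> - \<mu>) (Y \<omega> - \<mu>))"

definition predictable ::
  "(nat \<Rightarrow> 'w measure) \<Rightarrow> (nat \<Rightarrow> 'w \<Rightarrow> 'b::topological_space) \<Rightarrow> bool" where
  "predictable F l \<longleftrightarrow> (\<forall>t\<ge>1. l t \<in> borel_measurable (F (t - 1)))"

definition s_fun :: "real \<Rightarrow> real \<Rightarrow> real ^ 'd \<Rightarrow> real" where
  "s_fun v \<beta> x = (1 + 1 / \<beta>) * (norm x + v)\<^sup>2"

(* onorm, because norm on real ^ 'd ^ 'd is the Frobenius norm. *)
definition w_fun :: "real \<Rightarrow> real ^ 'd ^ 'd \<Rightarrow> real" where
  "w_fun \<beta> A = onorm ((*v) A) + trace A / \<beta>"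

end

theory Submission
  imports Defs
begin

text \<open>
  For a fixed direction \<open>\<theta>\<close> the elementary inequality \<open>exp (x - x\<^sup>2 / 6) \<le> 1 + x + x\<^sup>2 / 3\<close>
  shows that \<open>exp (\<Sum>\<^sub>i Y\<^sub>i - Y\<^sub>i\<^sup>2 / 6 - E[Y\<^sub>i\<^sup>2 | F\<^sub>i\<^sub>-\<^sub>1] / 3)\<close> is a supermartingale, where
  \<open>Y\<^sub>i = \<lambda>\<^sub>i \<theta> \<bullet> (X\<^sub>i - \<mu>)\<close>. Integrating over \<open>\<theta>\<close> with respect to the centred Gaussian of covariance
  \<open>I / \<beta>\<close> keeps it a supermartingale, so by Ville's inequality the mixture stays below
  \<open>1 / \<alpha>\<close> for all times with probability at least \<open>1 - \<alpha>\<close>. The exponent is quadratic in \<open>\<theta>\<close>,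
  so comparing the centred Gaussian with its translate by the unit vector \<open>u\<close> in the direction of
  \<open>\<Sum>\<^sub>i \<lambda>\<^sub>i (X\<^sub>i - \<mu>)\<close> (a PAC-Bayes argument whose price is \<open>\<beta> / 2\<close>) and applying Jensen's
  inequality bounds the norm of that sum. The trace terms come from the posterior covariance.
\<close>

section \<open>Ville's inequality\<close>

lemma ville_inequality:
  fixes L :: "nat \<Rightarrow> 'w \<Rightarrow> ennreal"
  assumes sub: "\<And>n. subalgebra M (F n)"
    and mono: "\<And>m n. m \<le> n \<Longrightarrow> sets (F m) \<subseteq> sets (F n)"
    and meas: "\<And>n. L n \<in> borel_measurable (F n)"
    and super: "\<And>n A. A \<in> sets (F n) \<Longrightarrow>
      (\<integral>\<^sup>+\<omega>\<in>A. L (Suc n) \<omega> \<partial>M) \<le> (\<integral>\<^sup>+\<omega>\<in>A. L n \<omega> \<partial>M)"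
  shows "c * emeasure M {\<omega> \<in> space M. \<exists>n. c \<le> L n \<omega>} \<le> (\<integral>\<^sup>+\<omega>. L 0 \<omega> \<partial>M)"
proof -
  define H where "H = (\<lambda>n. {\<omega> \<in> space M. \<exists>k\<le>n. c \<le> L k \<omega>})"
  have spaceF: "space (F n) = space M" and subset: "sets (F n) \<subseteq> sets M" for n
    using sub[of n] by (auto simp: subalgebra_def)
  have L_meas: "L k \<in> borel_measurable (F n)" if "k \<le> n" for k n
    using measurable_mono[of borel borel "F k" "F n"] mono[OF that] meas[of k]
    by (auto simp: spaceF)
  have [measurable]: "L n \<in> borel_measurable M" for n
    using measurable_from_subalg[OF sub meas] .
  have H_F: "H n \<in> sets (F n)" for n
  proof -
    have "{\<omega> \<in> space (F n). c \<le> L k \<omega>} \<in> sets (F n)" if "k \<le> n" for k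
      using L_meas[OF that] by measurable
    then have "(\<Union>k\<le>n. {\<omega> \<in> space (F n). c \<le> L k \<omega>}) \<in> sets (F n)"
      by (intro sets.countable_UN'') auto
    also have "(\<Union>k\<le>n. {\<omega> \<in> space (F n). c \<le> L k \<omega>}) = H n"
      by (auto simp: H_def spaceF)
    finally show ?thesis .
  qed
  have [measurable]: "H n \<in> sets M" for n
    using H_F subset by blast
  have main: "c * emeasure M (H n) + (\<integral>\<^sup>+\<omega>\<in>space M - H n. L n \<omega> \<partial>M) \<le> (\<integral>\<^sup>+\<omega>. L 0 \<omega> \<partial>M)"
    for n
  proof (induction n)
    case 0
    have "c * emeasure M (H 0) + (\<integral>\<^sup>+\<omega>\<in>space M - H 0. L 0 \<omega> \<partial>M) =
        (\<integral>\<^sup>+\<omega>. c * indicator (H 0) \<omega> + L 0 \<omega> * indicator (space M - H 0) \<omega> \<partial>M)"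
      by (subst nn_integral_add) (auto simp: nn_integral_cmult)
    also have "\<dots> \<le> (\<integral>\<^sup>+\<omega>. L 0 \<omega> \<partial>M)"
      by (intro nn_integral_mono) (auto simp: H_def indicator_def)
    finally show ?case .
  next
    case (Suc n)
    \<comment> \<open>\<open>J\<close> holds the paths that reach \<open>c\<close> for the first
      time at \<open>Suc n\<close>. There \<open>c \<le> L (Suc n)\<close>, so the integral of
      \<open>L (Suc n)\<close> over \<open>J\<close> pays for the newly frozen mass.\<close>
    define J where "J = H (Suc n) - H n"
    have [measurable]: "J \<in> sets M" by (simp add: J_def)
    have H_Suc: "H n \<subseteq> H (Suc n)"
      by (auto simp: H_def intro: le_SucI)
    have "emeasure M (H (Suc n)) = emeasure M (H n) + emeasure M J"
      using H_Suc by (subst plus_emeasure) (auto simp: J_def intro!: arg_cong[of _ _ "emeasure M"])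
    then have "c * emeasure M (H (Suc n)) + (\<integral>\<^sup>+\<omega>\<in>space M - H (Suc n). L (Suc n) \<omega> \<partial>M) =
        c * emeasure M (H n) +
        (c * emeasure M J + (\<integral>\<^sup>+\<omega>\<in>space M - H (Suc n). L (Suc n) \<omega> \<partial>M))"
      by (simp add: distrib_left add.assoc)
    also have "c * emeasure M J + (\<integral>\<^sup>+\<omega>\<in>space M - H (Suc n). L (Suc n) \<omega> \<partial>M) =
        (\<integral>\<^sup>+\<omega>. c * indicator J \<omega> + L (Suc n) \<omega> * indicator (space M - H (Suc n)) \<omega> \<partial>M)"
      by (subst nn_integral_add) (auto simp: nn_integral_cmult)
    also have "\<dots> \<le> (\<integral>\<^sup>+\<omega>\<in>space M - H n. L (Suc n) \<omega> \<partial>M)"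
      using H_Suc by (intro nn_integral_mono) (auto simp: J_def H_def indicator_def le_Suc_eq)
    also have "\<dots> \<le> (\<integral>\<^sup>+\<omega>\<in>space M - H n. L n \<omega> \<partial>M)"
      using H_F[of n] by (intro super) (metis sets.compl_sets spaceF)
    finally show ?case
      using Suc.IH by (meson add_left_mono order_trans)
  qed
  have "incseq H"
    by (auto simp: incseq_def H_def intro: order_trans)
  have "c * emeasure M (\<Union>n. H n) = (SUP n. c * emeasure M (H n))"
    using \<open>incseq H\<close> by (subst SUP_mult_left_ennreal[symmetric]) (simp add: SUP_emeasure_incseq image_subset_iff)
  also have "\<dots> \<le> (\<integral>\<^sup>+\<omega>. L 0 \<omega> \<partial>M)"
    using main by (intro SUP_least) (meson le_iff_add order_trans)
  also have "(\<Union>n. H n) = {\<omega> \<in> space M. \<exists>n. c \<le> L n \<omega>}"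
    by (auto simp: H_def)
  finally show ?thesis .
qed

section \<open>Gaussian mixtures\<close>

text \<open>The normal law with mean \<open>u\<close> and covariance I / \<beta>. It lives on
  functions of the index rather than on vectors, so that product-measure facts about
  \<open>PiM\<close> apply coordinate by coordinate.\<close>

definition gauss_measure :: "real \<Rightarrow> ('d::finite \<Rightarrow> real) \<Rightarrow> ('d \<Rightarrow> real) measure" where
  "gauss_measure \<beta> u = PiM UNIV (\<lambda>i. density lborel (normal_density (u i) (1 / sqrt \<beta>)))"

lemma sets_gauss_measure [measurable_cong]:
  "sets (gauss_measure \<beta> u) = sets (PiM UNIV (\<lambda>i::'d::finite. borel))"
  unfolding gauss_measure_def by (intro sets_PiM_cong) auto

lemma product_prob_space_normal:
  assumes "\<beta> > 0"
  shows "product_prob_space (\<lambda>i. density lborel (normal_density (u i) (1 / sqrt \<beta>)))"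
  using assms prob_space_normal_density[of "1 / sqrt \<beta>"]
  by (auto simp: product_prob_space_def product_prob_space_axioms_def product_sigma_finite_def
      prob_space_imp_sigma_finite)

lemma prob_space_gauss_measure: "\<beta> > 0 \<Longrightarrow> prob_space (gauss_measure \<beta> u)"
  unfolding gauss_measure_def
  using prob_space_normal_density[of "1 / sqrt \<beta>"] by (intro prob_space_PiM) auto

text \<open>The coordinates are independent, so each moment is a product of one-dimensional moments,
  with the constant 1 as the factor for every coordinate not involved.\<close>

lemma gauss_measure_moments:
  fixes u :: "'d::finite \<Rightarrow> real"
  assumes "\<beta> > 0"
  shows "has_bochner_integral (gauss_measure \<beta> u) (\<lambda>\<theta>. \<theta> j) (u j)"
    and "has_bochner_integral (gauss_measure \<beta> u) (\<lambda>\<theta>. \<theta> j * \<theta> k)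
      (u j * u k + (if j = k then 1 / \<beta> else 0))"
proof -
  define N where "N = (\<lambda>i. density lborel (normal_density (u i) (1 / sqrt \<beta>)))"
  have [measurable_cong]: "sets (N i) = sets borel" for i by (simp add: N_def)
  interpret product_prob_space N
    unfolding N_def by (rule product_prob_space_normal[OF assms])
  have \<sigma>: "1 / sqrt \<beta> > 0" using assms by simp
  have m0: "has_bochner_integral (N i) (\<lambda>x. 1) (1::real)" for i
    using M.prob_space[of i] by (simp add: has_bochner_integral_iff)
  have m1: "has_bochner_integral (N i) (\<lambda>x. x) (u i)" for i
    using normal_moment_nz_1[OF \<sigma>, of "u i"]
    by (simp add: N_def has_bochner_integral_density)
  have m2: "has_bochner_integral (N i) (\<lambda>x. x * x) (u i * u i + 1 / \<beta>)" for i
  proof -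
    have "has_bochner_integral (N i) (\<lambda>x. (x - u i)\<^sup>2) (1 / \<beta>)"
      using normal_moment_even[OF \<sigma>, of "u i" 1] assms
      by (simp add: N_def has_bochner_integral_density power_divide)
    then have "has_bochner_integral (N i) (\<lambda>x. (x - u i)\<^sup>2 + 2 * u i * x - u i * u i * 1)
        (1 / \<beta> + 2 * u i * u i - u i * u i * 1)"
      using m0[of i] m1[of i]
      by (intro has_bochner_integral_add has_bochner_integral_diff has_bochner_integral_mult_right)
        auto
    then show ?thesis
      by (simp add: power2_eq_square algebra_simps)
  qed
  have prod: "has_bochner_integral (gauss_measure \<beta> u) (\<lambda>\<theta>. \<Prod>i\<in>UNIV. f i (\<theta> i))
      (\<Prod>i\<in>UNIV. c i)"
    if "\<And>i. has_bochner_integral (N i) (f i) (c i)" for f :: "'d \<Rightarrow> real \<Rightarrow> real" and c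
    using that product_integrable_prod[of UNIV f] product_integral_prod[of UNIV f]
    by (auto simp: gauss_measure_def N_def[symmetric] has_bochner_integral_iff)
  show "has_bochner_integral (gauss_measure \<beta> u) (\<lambda>\<theta>. \<theta> j) (u j)"
    using prod[of "\<lambda>i x. if i = j then x else 1" "\<lambda>i. if i = j then u i else 1"] m0 m1
    by (simp add: if_distrib cong: if_cong)
  show "has_bochner_integral (gauss_measure \<beta> u) (\<lambda>\<theta>. \<theta> j * \<theta> k)
      (u j * u k + (if j = k then 1 / \<beta> else 0))"
  proof (cases "j = k")
    case True
    then show ?thesis
      using prod[of "\<lambda>i x. if i = j then x * x else 1"
          "\<lambda>i. if i = j then u i * u i + 1 / \<beta> else 1"] m0 m2
      by (simp add: if_distrib cong: if_cong)
  next
    case False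
    have "has_bochner_integral (gauss_measure \<beta> u)
        (\<lambda>\<theta>. \<Prod>i\<in>UNIV. (if i = j then \<theta> i else 1) * (if i = k then \<theta> i else 1))
        (\<Prod>i\<in>UNIV. (if i = j then u i else 1) * (if i = k then u i else 1))"
      using False m0 m1
      by (intro prod[of "\<lambda>i x. (if i = j then x else 1) * (if i = k then x else 1)"]) auto
    then show ?thesis
      using False by (simp add: prod.distrib)
  qed
qed

text \<open>In one dimension the density of mean 0 divided by that of mean \<open>u i\<close> is
  \<open>exp (\<beta> * (u i)\<^sup>2 / 2 - \<beta> * u i * x)\<close>. These ratios multiply over
  coordinates, and agreement of the two measures on boxes suffices.\<close>

lemma gauss_measure_shift:
  fixes u :: "'d::finite \<Rightarrow> real"
  assumes "\<beta> > 0"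
  shows "gauss_measure \<beta> (\<lambda>_. 0) =
    density (gauss_measure \<beta> u) (\<lambda>\<theta>. ennreal (exp (\<Sum>i\<in>UNIV. \<beta> * (u i)\<^sup>2 / 2 - \<beta> * u i * \<theta> i)))"
proof -
  define N where "N = (\<lambda>m. density lborel (normal_density m (1 / sqrt \<beta>)))"
  define r where "r = (\<lambda>i x. ennreal (exp (\<beta> * (u i)\<^sup>2 / 2 - \<beta> * u i * x)))"
  have [measurable_cong]: "sets (N i) = sets borel" for i by (simp add: N_def)
  have [measurable]: "r i \<in> borel_measurable borel" for i by (simp add: r_def)
  have \<sigma>: "1 / sqrt \<beta> > 0" using assms by simp
  interpret U: product_prob_space "\<lambda>i. N (u i)"
    unfolding N_def by (rule product_prob_space_normal[OF assms])
  interpret Z: product_prob_space "\<lambda>i::'d. N 0"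
    unfolding N_def by (rule product_prob_space_normal[OF assms])
  have N_shift: "emeasure (N 0) A = (\<integral>\<^sup>+x. r i x * indicator A x \<partial>N (u i))"
    if [measurable]: "A \<in> sets borel" for A i
  proof -
    have "normal_density (u i) (1 / sqrt \<beta>) x * exp (\<beta> * (u i)\<^sup>2 / 2 - \<beta> * u i * x) =
        normal_density 0 (1 / sqrt \<beta>) x" for x
      using assms
      by (simp add: normal_density_def mult_exp_exp power2_eq_square field_simps)
    then have "ennreal (normal_density (u i) (1 / sqrt \<beta>) x) * r i x =
        ennreal (normal_density 0 (1 / sqrt \<beta>) x)" for x
      by (simp add: r_def ennreal_mult'[symmetric])
    then show ?thesis
      by (simp add: N_def emeasure_density nn_integral_density mult.assoc[symmetric])
  qed
  have "density (PiM UNIV (\<lambda>i. N (u i))) (\<lambda>\<theta>. \<Prod>i\<in>UNIV. r i (\<theta> i)) = PiM UNIV (\<lambda>i::'d. N 0)"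
  proof (rule Z.PiM_eqI)
    fix A :: "'d \<Rightarrow> real set"
    assume "\<And>i. i \<in> UNIV \<Longrightarrow> A i \<in> sets (N 0)"
    then have A[measurable]: "A i \<in> sets borel" for i by (simp add: N_def)
    have [measurable]: "Pi\<^sub>E UNIV A \<in> sets (PiM UNIV (\<lambda>i. N (u i)))"
      by (intro sets_PiM_I_finite) auto
    have "emeasure (density (PiM UNIV (\<lambda>i. N (u i))) (\<lambda>\<theta>. \<Prod>i\<in>UNIV. r i (\<theta> i))) (Pi\<^sub>E UNIV A) =
        (\<integral>\<^sup>+\<theta>. (\<Prod>i\<in>UNIV. r i (\<theta> i)) * indicator (Pi\<^sub>E UNIV A) \<theta> \<partial>PiM UNIV (\<lambda>i. N (u i)))"
      by (subst emeasure_density) auto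
    also have "\<dots> = (\<integral>\<^sup>+\<theta>. (\<Prod>i\<in>UNIV. r i (\<theta> i) * indicator (A i) (\<theta> i)) \<partial>PiM UNIV (\<lambda>i. N (u i)))"
    proof (intro nn_integral_cong)
      fix \<theta> :: "'d \<Rightarrow> real"
      have "indicator (Pi\<^sub>E UNIV A) \<theta> = (\<Prod>i\<in>UNIV. indicator (A i) (\<theta> i) :: ennreal)"
        by (auto simp: indicator_def PiE_iff)
      then show "(\<Prod>i\<in>UNIV. r i (\<theta> i)) * indicator (Pi\<^sub>E UNIV A) \<theta> =
          (\<Prod>i\<in>UNIV. r i (\<theta> i) * indicator (A i) (\<theta> i))"
        by (simp add: prod.distrib)
    qed
    also have "\<dots> = (\<Prod>i\<in>UNIV. \<integral>\<^sup>+x. r i x * indicator (A i) x \<partial>N (u i))"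
      by (rule U.product_nn_integral_prod) auto
    also have "\<dots> = (\<Prod>i\<in>UNIV. emeasure (N 0) (A i))"
      using A by (simp add: N_shift[symmetric])
    finally show "emeasure (density (PiM UNIV (\<lambda>i. N (u i))) (\<lambda>\<theta>. \<Prod>i\<in>UNIV. r i (\<theta> i)))
        (Pi\<^sub>E UNIV A) = (\<Prod>i\<in>UNIV. emeasure (N 0) (A i))" .
  next
    show "sets (density (PiM UNIV (\<lambda>i. N (u i))) (\<lambda>\<theta>. \<Prod>i\<in>UNIV. r i (\<theta> i))) =
        sets (PiM UNIV (\<lambda>i::'d. N 0))"
      by (simp, intro sets_PiM_cong) (auto simp: N_def)
  qed simp
  moreover have "(\<Prod>i\<in>UNIV. r i (\<theta> i)) =
      ennreal (exp (\<Sum>i\<in>UNIV. \<beta> * (u i)\<^sup>2 / 2 - \<beta> * u i * \<theta> i))" for \<theta>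
    by (simp add: r_def exp_sum prod_ennreal)
  ultimately show ?thesis
    by (simp add: gauss_measure_def N_def)
qed

text \<open>Jensen's inequality for exp, by integrating the tangent line at \<open>m\<close>. If
  \<open>exp (g x)\<close> is not integrable, the right-hand side is infinite.\<close>

lemma exp_expectation_le:
  assumes "prob_space P" and g: "has_bochner_integral P g m"
  shows "ennreal (exp m) \<le> (\<integral>\<^sup>+x. ennreal (exp (g x)) \<partial>P)"
proof (cases "integrable P (\<lambda>x. exp (g x))")
  case True
  interpret prob_space P by fact
  have int: "integrable P g" and m: "integral\<^sup>L P g = m"
    using g by (auto simp: has_bochner_integral_iff)
  have "exp m = (\<integral>x. exp m * (1 + (g x - m)) \<partial>P)"
    using int m by (simp add: prob_space)
  also have "\<dots> \<le> (\<integral>x. exp (g x) \<partial>P)"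
  proof (rule integral_mono)
    fix x
    have "exp m * (1 + (g x - m)) \<le> exp m * exp (g x - m)"
      by (intro mult_left_mono exp_ge_add_one_self) auto
    then show "exp m * (1 + (g x - m)) \<le> exp (g x)"
      by (simp add: mult_exp_exp)
  qed (use int True in auto)
  finally show ?thesis
    using True by (simp add: nn_integral_eq_integral)
next
  case False
  have "g \<in> borel_measurable P"
    using g by (auto simp: has_bochner_integral_iff)
  then have "(\<integral>\<^sup>+x. ennreal (exp (g x)) \<partial>P) = \<infinity>"
    using False by (auto simp: integrable_iff_bounded less_top[symmetric])
  then show ?thesis by simp
qed

text \<open>The Gibbs variational bound \<open>ln (E e\<^sup>f) \<ge> E\<^sub>u f - KL\<close> for the translate by \<open>u\<close>,
  whose divergence from the centred Gaussian is \<open>\<beta> \<bar>u\<bar>\<^sup>2 / 2\<close>.\<close>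

lemma gauss_mixture_lower_bound:
  fixes u a :: "'d::finite \<Rightarrow> real" and Q :: "'d \<Rightarrow> 'd \<Rightarrow> real"
  assumes "\<beta> > 0"
  shows "ennreal (exp ((\<Sum>j\<in>UNIV. a j * u j) - (\<Sum>j\<in>UNIV. \<Sum>k\<in>UNIV. Q j k * (u j * u k))
        - (\<Sum>j\<in>UNIV. Q j j) / \<beta> - \<beta> * (\<Sum>j\<in>UNIV. (u j)\<^sup>2) / 2))
    \<le> (\<integral>\<^sup>+\<theta>. ennreal (exp ((\<Sum>j\<in>UNIV. a j * \<theta> j)
        - (\<Sum>j\<in>UNIV. \<Sum>k\<in>UNIV. Q j k * (\<theta> j * \<theta> k)))) \<partial>gauss_measure \<beta> (\<lambda>_. 0))"
    (is "ennreal (exp ?m) \<le> (\<integral>\<^sup>+\<theta>. ennreal (exp (?f \<theta>)) \<partial>_)")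
proof -
  let ?s = "\<lambda>\<theta>. \<Sum>j\<in>UNIV. \<beta> * (u j)\<^sup>2 / 2 - \<beta> * u j * \<theta> j"
  let ?P = "gauss_measure \<beta> u"
  interpret P: prob_space ?P by (rule prob_space_gauss_measure[OF assms])
  note mom = gauss_measure_moments[OF assms, of u]
  \<comment> \<open>Under the translate, the diagonal covariance 1 / \<beta> turns the quadratic
    form into its value at \<open>u\<close> plus the trace of \<open>Q\<close> divided by \<beta>.
    The mean of \<open>?s\<close> is minus \<beta> / 2 times the squared length of \<open>u\<close>,
    the divergence term.\<close>
  have "has_bochner_integral ?P (\<lambda>\<theta>. ?f \<theta> + ?s \<theta>)
     ((\<Sum>j\<in>UNIV. a j * u j)
        - (\<Sum>j\<in>UNIV. \<Sum>k\<in>UNIV. Q j k * (u j * u k + (if j = k then 1 / \<beta> else 0)))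
        + (\<Sum>j\<in>UNIV. \<beta> * (u j)\<^sup>2 / 2 - \<beta> * u j * u j))"
    using mom P.prob_space
    by (intro has_bochner_integral_add has_bochner_integral_diff has_bochner_integral_sum
        has_bochner_integral_mult_right) (auto simp: has_bochner_integral_iff)
  also have "(\<Sum>j\<in>UNIV. a j * u j)
        - (\<Sum>j\<in>UNIV. \<Sum>k\<in>UNIV. Q j k * (u j * u k + (if j = k then 1 / \<beta> else 0)))
        + (\<Sum>j\<in>UNIV. \<beta> * (u j)\<^sup>2 / 2 - \<beta> * u j * u j) = ?m"
    by (simp add: distrib_left sum.distrib sum_divide_distrib sum_distrib_left sum_subtractf
        power2_eq_square sum_negf[symmetric] if_distrib[of "\<lambda>x. _ * x"] cong: if_cong)
  finally have "ennreal (exp ?m) \<le> (\<integral>\<^sup>+\<theta>. ennreal (exp (?f \<theta> + ?s \<theta>)) \<partial>?P)"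
    by (rule exp_expectation_le[OF P.prob_space_axioms])
  also have "\<dots> = (\<integral>\<^sup>+\<theta>. ennreal (exp (?s \<theta>)) * ennreal (exp (?f \<theta>)) \<partial>?P)"
    by (simp add: exp_add ennreal_mult' mult.commute)
  also have "\<dots> = (\<integral>\<^sup>+\<theta>. ennreal (exp (?f \<theta>)) \<partial>gauss_measure \<beta> (\<lambda>_. 0))"
    unfolding gauss_measure_shift[OF assms, of u] by (subst nn_integral_density) auto
  finally show ?thesis .
qed

section \<open>The supermartingale increment\<close>

text \<open>After taking logarithms, the difference \<open>h\<close> of the two sides has derivative
  \<open>x ^ 3 / (9 * D x)\<close>: the constants 1/6 and 1/3 are such that all lower powers cancel.
  Since \<open>D\<close> is positive, this has the sign of \<open>x\<close>, so \<open>h\<close> is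
  minimal at 0, where it vanishes.\<close>

lemma exp_quadratic_le:
  fixes x :: real
  shows "exp (x - x\<^sup>2 / 6) \<le> 1 + x + x\<^sup>2 / 3"
proof -
  define D where "D = (\<lambda>x::real. 1 + x + x\<^sup>2 / 3)"
  define h where "h = (\<lambda>x. ln (D x) - x + x\<^sup>2 / 6)"
  have D_pos: "D x > 0" for x
  proof -
    have "D x = (x + 3/2)\<^sup>2 / 3 + 1/4"
      by (simp add: D_def power2_eq_square field_simps)
    then show ?thesis
      by (simp add: add_nonneg_pos)
  qed
  have deriv: "(h has_real_derivative x ^ 3 / (9 * D x)) (at x)" for x
  proof -
    have "(h has_real_derivative (1 + 2 * x / 3) / D x - 1 + x / 3) (at x)"
    proof -
      have "(D has_real_derivative 1 + 2 * x / 3) (at x)"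
        unfolding D_def by (auto intro!: derivative_eq_intros)
      then show ?thesis
        unfolding h_def using D_pos[of x]
        by (auto intro!: derivative_eq_intros)
    qed
    moreover have "(1 + 2 * x / 3) / D x - 1 + x / 3 = x ^ 3 / (9 * D x)"
    proof -
      have "9 * (1 + 2 * x / 3) + (3 * x - 9) * D x = x ^ 3"
        by (simp add: D_def power2_eq_square power3_eq_cube algebra_simps)
      then show ?thesis
        using D_pos[of x] by (simp add: field_simps)
    qed
    ultimately show ?thesis by simp
  qed
  have "h 0 \<le> h x"
  proof (cases "x \<ge> 0")
    case True
    show ?thesis
    proof (rule DERIV_nonneg_imp_nondecreasing[OF True])
      fix y :: real assume "0 \<le> y"
      then show "\<exists>d. (h has_real_derivative d) (at y) \<and> 0 \<le> d"
        using deriv[of y] D_pos[of y] by (intro exI[of _ "y ^ 3 / (9 * D y)"]) auto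
    qed
  next
    case False
    show ?thesis
    proof (rule DERIV_nonpos_imp_nonincreasing[of x 0])
      fix y :: real assume "y \<le> 0"
      then have "y ^ 3 \<le> 0" by (simp add: power3_eq_cube mult_nonneg_nonpos mult_nonpos_nonpos)
      then show "\<exists>d. (h has_real_derivative d) (at y) \<and> d \<le> 0"
        using deriv[of y] D_pos[of y]
        by (intro exI[of _ "y ^ 3 / (9 * D y)"]) (auto simp: divide_nonpos_pos)
    qed (use False in simp)
  qed
  then have "x - x\<^sup>2 / 6 \<le> ln (D x)"
    by (simp add: h_def D_def)
  then have "exp (x - x\<^sup>2 / 6) \<le> D x"
    using D_pos[of x] by (metis exp_le_cancel_iff exp_ln)
  then show ?thesis by (simp add: D_def)
qed

text \<open>Conditionally on \<open>F\<close>, the quadratic bound on exp gives at most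
  \<open>1 + l\<^sup>2 * S / 3\<close>, which is at most \<open>exp (l\<^sup>2 * S / 3)\<close> and
  is compensated by the last term of the exponent. The weight \<open>W\<close> stands for the past
  of the process times the indicator of a past event.\<close>

lemma (in prob_space) delyon_supermartingale_step:
  fixes Y l S W :: "'a \<Rightarrow> real"
  assumes sub: "subalgebra M F"
    and Y: "integrable M Y" "integrable M (\<lambda>\<omega>. (Y \<omega>)\<^sup>2)"
    and mean: "AE \<omega> in M. real_cond_exp M F Y \<omega> = 0"
    and var: "AE \<omega> in M. real_cond_exp M F (\<lambda>\<omega>. (Y \<omega>)\<^sup>2) \<omega> = S \<omega>"
    and F_meas [measurable]: "l \<in> borel_measurable F" "S \<in> borel_measurable F"
      "W \<in> borel_measurable F"
    and W_nonneg: "\<And>\<omega>. W \<omega> \<ge> 0"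
  shows "(\<integral>\<^sup>+\<omega>. ennreal (W \<omega> * exp (l \<omega> * Y \<omega> - (l \<omega> * Y \<omega>)\<^sup>2 / 6 - (l \<omega>)\<^sup>2 * S \<omega> / 3)) \<partial>M)
    \<le> (\<integral>\<^sup>+\<omega>. ennreal (W \<omega>) \<partial>M)"
proof -
  interpret finite_measure_subalgebra M F
    using sub by unfold_locales
  define E where "E = (\<lambda>\<omega>. exp (l \<omega> * Y \<omega> - (l \<omega> * Y \<omega>)\<^sup>2 / 6 - (l \<omega>)\<^sup>2 * S \<omega> / 3))"
  \<comment> \<open>\<open>W\<close>, \<open>l\<close> and \<open>S\<close> may be unbounded; on \<open>C K\<close> everything is integrable, and \<open>C K\<close> exhausts the space.\<close>
  define C where "C = (\<lambda>K::nat. {\<omega> \<in> space F. W \<omega> \<le> real K \<and> \<bar>l \<omega>\<bar> \<le> real K \<and> \<bar>S \<omega>\<bar> \<le> real K})"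
  have space_F: "space F = space M"
    using sub by (simp add: subalgebra_def)
  have [measurable]: "Y \<in> borel_measurable M"
    using Y(1) by auto
  note M_meas [measurable] = F_meas[THEN measurable_from_subalg[OF sub]]
  have C_F [measurable]: "C K \<in> sets F" for K
    unfolding C_def by measurable
  then have C_M [measurable]: "C K \<in> sets M" for K
    using sub by (auto simp: subalgebra_def)
  have [measurable]: "E \<in> borel_measurable M"
    unfolding E_def by measurable
  have truncated: "(\<integral>\<^sup>+\<omega>. ennreal (W \<omega> * E \<omega>) * indicator (C K) \<omega> \<partial>M) \<le> (\<integral>\<^sup>+\<omega>. ennreal (W \<omega>) \<partial>M)"
    for K
  proof -
    \<comment> \<open>\<open>w\<close> collects every factor that is known given \<open>F\<close>.
      The sign of \<open>S\<close> is not assumed, so \<open>B\<close> bounds the compensating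
      exponential through the absolute value of \<open>S\<close>.\<close>
    define w where "w = (\<lambda>\<omega>. indicator (C K) \<omega> * (W \<omega> * exp (- ((l \<omega>)\<^sup>2 * S \<omega> / 3))))"
    define B where "B = real K * exp (real K ^ 2 * real K / 3)"
    have [measurable]: "w \<in> borel_measurable F"
      unfolding w_def by measurable
    have [measurable]: "w \<in> borel_measurable M"
      unfolding w_def by measurable
    have w_nonneg: "0 \<le> w \<omega>" for \<omega>
      using W_nonneg by (simp add: w_def)
    have w_le: "w \<omega> \<le> B" for \<omega>
    proof (cases "\<omega> \<in> C K")
      case True
      have "- ((l \<omega>)\<^sup>2 * S \<omega>) \<le> (l \<omega>)\<^sup>2 * \<bar>S \<omega>\<bar>"
        by (metis abs_ge_minus_self minus_mult_right mult_left_mono zero_le_power2)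
      also have "\<dots> \<le> real K ^ 2 * real K"
        using True by (intro mult_mono) (auto simp: C_def abs_le_square_iff[symmetric])
      finally show ?thesis
        using True W_nonneg by (auto simp: w_def B_def C_def intro!: mult_mono)
    qed (simp add: w_def B_def)
    have bounded_integrable: "integrable M (\<lambda>\<omega>. h \<omega> * g \<omega>)"
      if [measurable]: "h \<in> borel_measurable M" and "integrable M g" and "\<And>\<omega>. \<bar>h \<omega>\<bar> \<le> c"
      for h g :: "'a \<Rightarrow> real" and c
    proof (rule Bochner_Integration.integrable_bound)
      show "integrable M (\<lambda>\<omega>. c * g \<omega>)"
        using that by simp
      show "(\<lambda>\<omega>. h \<omega> * g \<omega>) \<in> borel_measurable M"
        using that by simp
      show "AE \<omega> in M. norm (h \<omega> * g \<omega>) \<le> norm (c * g \<omega>)"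
        using that(3) by (intro AE_I2) (auto simp: abs_mult intro!: mult_right_mono order_trans[OF that(3)])
    qed
    have w_outside: "w \<omega> = 0" if "\<omega> \<notin> C K" for \<omega>
      using that by (simp add: w_def)
    have B_nonneg: "0 \<le> B" by (simp add: B_def)
    have w1: "\<bar>w \<omega> * l \<omega>\<bar> \<le> B * real K" for \<omega>
    proof (cases "\<omega> \<in> C K")
      case True
      then have "w \<omega> * \<bar>l \<omega>\<bar> \<le> B * real K"
        using w_le[of \<omega>] B_nonneg by (intro mult_mono) (auto simp: C_def)
      then show ?thesis
        using w_nonneg[of \<omega>] by (simp add: abs_mult)
    qed (simp add: w_outside B_nonneg)
    have w2: "\<bar>w \<omega> * (l \<omega>)\<^sup>2\<bar> \<le> B * real K ^ 2" for \<omega>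
    proof (cases "\<omega> \<in> C K")
      case True
      then have "w \<omega> * (l \<omega>)\<^sup>2 \<le> B * real K ^ 2"
        using w_le[of \<omega>] B_nonneg
        by (intro mult_mono) (auto simp: C_def abs_le_square_iff[symmetric])
      then show ?thesis
        using w_nonneg[of \<omega>] by (simp add: abs_mult)
    qed (simp add: w_outside B_nonneg)
    have w3: "\<bar>w \<omega> * (l \<omega>)\<^sup>2 * S \<omega>\<bar> \<le> B * real K ^ 2 * real K" for \<omega>
    proof (cases "\<omega> \<in> C K")
      case True
      then show ?thesis
        using w2[of \<omega>] unfolding abs_mult[of _ "S \<omega>"]
        by (intro mult_mono) (auto simp: C_def)
    qed (simp add: w_outside B_nonneg)
    have int0: "integrable M w"
      using bounded_integrable[of w "\<lambda>_. 1" B] w_nonneg w_le by simp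
    have int1: "integrable M (\<lambda>\<omega>. w \<omega> * l \<omega> * Y \<omega>)"
      using Y w1 by (intro bounded_integrable) auto
    have int2: "integrable M (\<lambda>\<omega>. w \<omega> * (l \<omega>)\<^sup>2 * (Y \<omega>)\<^sup>2)"
      using Y w2 by (intro bounded_integrable) auto
    have int3: "integrable M (\<lambda>\<omega>. w \<omega> * (l \<omega>)\<^sup>2 * S \<omega>)"
      using bounded_integrable[of "\<lambda>\<omega>. w \<omega> * (l \<omega>)\<^sup>2 * S \<omega>" "\<lambda>_. 1", OF _ _ w3] by simp
    have int_W: "integrable M (\<lambda>\<omega>. indicator (C K) \<omega> * W \<omega>)"
    proof -
      have "\<bar>indicator (C K) \<omega> * W \<omega>\<bar> \<le> real K" for \<omega>
        using W_nonneg[of \<omega>] by (cases "\<omega> \<in> C K") (simp_all add: C_def)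
      moreover have "(\<lambda>\<omega>. indicator (C K) \<omega> * W \<omega>) \<in> borel_measurable M"
        by measurable
      moreover have "integrable M (\<lambda>_. 1 :: real)"
        by simp
      ultimately show ?thesis
        using bounded_integrable[of "\<lambda>\<omega>. indicator (C K) \<omega> * W \<omega>" "\<lambda>_. 1" "real K"] by simp
    qed
    \<comment> \<open>The factors measurable in \<open>F\<close> come out of the conditional
      expectation: the linear term vanishes here, and below the square of \<open>Y\<close> is
      replaced by \<open>S\<close>.\<close>
    have "(\<integral>\<omega>. w \<omega> * l \<omega> * Y \<omega> \<partial>M) = (\<integral>\<omega>. w \<omega> * l \<omega> * real_cond_exp M F Y \<omega> \<partial>M)"
      using int1 by (intro real_cond_exp_intg(2)[symmetric]) auto
    also have "\<dots> = (\<integral>\<omega>. 0 \<partial>M)"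
      using mean by (intro integral_cong_AE) auto
    finally have E1: "(\<integral>\<omega>. w \<omega> * l \<omega> * Y \<omega> \<partial>M) = 0"
      by simp
    have "(\<integral>\<omega>. w \<omega> * (l \<omega>)\<^sup>2 * (Y \<omega>)\<^sup>2 \<partial>M) =
        (\<integral>\<omega>. w \<omega> * (l \<omega>)\<^sup>2 * real_cond_exp M F (\<lambda>\<omega>. (Y \<omega>)\<^sup>2) \<omega> \<partial>M)"
      using int2 by (intro real_cond_exp_intg(2)[symmetric]) auto
    also have "\<dots> = (\<integral>\<omega>. w \<omega> * (l \<omega>)\<^sup>2 * S \<omega> \<partial>M)"
      using var by (intro integral_cong_AE) auto
    finally have E2: "(\<integral>\<omega>. w \<omega> * (l \<omega>)\<^sup>2 * (Y \<omega>)\<^sup>2 \<partial>M) = (\<integral>\<omega>. w \<omega> * (l \<omega>)\<^sup>2 * S \<omega> \<partial>M)" .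
    let ?q = "\<lambda>\<omega>. w \<omega> + w \<omega> * l \<omega> * Y \<omega> + w \<omega> * (l \<omega>)\<^sup>2 * (Y \<omega>)\<^sup>2 / 3"
    have q: "w \<omega> * exp (l \<omega> * Y \<omega> - (l \<omega> * Y \<omega>)\<^sup>2 / 6) \<le> ?q \<omega>" for \<omega>
      using mult_left_mono[OF exp_quadratic_le[of "l \<omega> * Y \<omega>"] w_nonneg[of \<omega>]]
      by (simp add: algebra_simps)
    have int_q: "integrable M ?q"
      using int0 int1 int2 by simp
    have WE: "ennreal (W \<omega> * E \<omega>) * indicator (C K) \<omega> =
        ennreal (w \<omega> * exp (l \<omega> * Y \<omega> - (l \<omega> * Y \<omega>)\<^sup>2 / 6))" for \<omega>
    proof -
      have "exp (l \<omega> * Y \<omega> - (l \<omega> * Y \<omega>)\<^sup>2 / 6 - (l \<omega>)\<^sup>2 * S \<omega> / 3) =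
          exp (- ((l \<omega>)\<^sup>2 * S \<omega> / 3)) * exp (l \<omega> * Y \<omega> - (l \<omega> * Y \<omega>)\<^sup>2 / 6)"
        by (simp add: mult_exp_exp)
      then show ?thesis
        by (simp add: w_def E_def mult.assoc indicator_def)
    qed
    have "(\<integral>\<^sup>+\<omega>. ennreal (W \<omega> * E \<omega>) * indicator (C K) \<omega> \<partial>M) \<le> (\<integral>\<^sup>+\<omega>. ennreal (?q \<omega>) \<partial>M)"
      unfolding WE by (intro nn_integral_mono ennreal_leI q)
    also have "\<dots> = ennreal (\<integral>\<omega>. ?q \<omega> \<partial>M)"
    proof (rule nn_integral_eq_integral[OF int_q], rule AE_I2)
      fix \<omega>
      have "0 \<le> w \<omega> * exp (l \<omega> * Y \<omega> - (l \<omega> * Y \<omega>)\<^sup>2 / 6)"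
        using w_nonneg by simp
      then show "0 \<le> ?q \<omega>"
        using q[of \<omega>] by linarith
    qed
    also have "(\<integral>\<omega>. ?q \<omega> \<partial>M) = (\<integral>\<omega>. w \<omega> + w \<omega> * (l \<omega>)\<^sup>2 * S \<omega> / 3 \<partial>M)"
      using int0 int1 int2 int3 E1 E2 by simp
    also have "\<dots> \<le> (\<integral>\<omega>. indicator (C K) \<omega> * W \<omega> \<partial>M)"
    proof (rule integral_mono)
      fix \<omega>
      \<comment> \<open>The exponential on the right cancels the compensating factor inside
        \<open>w\<close>, leaving only the truncated \<open>W\<close>.\<close>
      have "w \<omega> * (1 + (l \<omega>)\<^sup>2 * S \<omega> / 3) \<le> w \<omega> * exp ((l \<omega>)\<^sup>2 * S \<omega> / 3)"
        by (intro mult_left_mono exp_ge_add_one_self w_nonneg)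
      also have "\<dots> = indicator (C K) \<omega> * W \<omega>"
        by (simp add: w_def mult.assoc mult_exp_exp)
      finally show "w \<omega> + w \<omega> * (l \<omega>)\<^sup>2 * S \<omega> / 3 \<le> indicator (C K) \<omega> * W \<omega>"
        by (simp add: algebra_simps)
    qed (use int0 int3 int_W in auto)
    also have "ennreal (\<integral>\<omega>. indicator (C K) \<omega> * W \<omega> \<partial>M) =
        (\<integral>\<^sup>+\<omega>. ennreal (indicator (C K) \<omega> * W \<omega>) \<partial>M)"
      using W_nonneg by (intro nn_integral_eq_integral[symmetric] int_W) auto
    also have "\<dots> \<le> (\<integral>\<^sup>+\<omega>. ennreal (W \<omega>) \<partial>M)"
      using W_nonneg by (intro nn_integral_mono ennreal_leI) (auto simp: indicator_def)
    finally show ?thesis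
      by (simp add: ennreal_leI)
  qed
  have C_exhaust: "ennreal (W \<omega> * E \<omega>) = (SUP K. ennreal (W \<omega> * E \<omega>) * indicator (C K) \<omega>)"
    if "\<omega> \<in> space M" for \<omega>
  proof (rule antisym)
    obtain K :: nat where "max (W \<omega>) (max \<bar>l \<omega>\<bar> \<bar>S \<omega>\<bar>) \<le> real K"
      using real_arch_simple by blast
    then have "\<omega> \<in> C K"
      using that by (auto simp: C_def space_F)
    then show "ennreal (W \<omega> * E \<omega>) \<le> (SUP K. ennreal (W \<omega> * E \<omega>) * indicator (C K) \<omega>)"
      by (intro SUP_upper2[of K]) auto
    show "(SUP K. ennreal (W \<omega> * E \<omega>) * indicator (C K) \<omega>) \<le> ennreal (W \<omega> * E \<omega>)"
      by (intro SUP_least) (auto simp: indicator_def)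
  qed
  have "(\<integral>\<^sup>+\<omega>. ennreal (W \<omega> * E \<omega>) \<partial>M) =
      (\<integral>\<^sup>+\<omega>. (SUP K. ennreal (W \<omega> * E \<omega>) * indicator (C K) \<omega>) \<partial>M)"
    by (intro nn_integral_cong C_exhaust)
  also have "\<dots> = (SUP K. \<integral>\<^sup>+\<omega>. ennreal (W \<omega> * E \<omega>) * indicator (C K) \<omega> \<partial>M)"
  proof (rule nn_integral_monotone_convergence_SUP)
    show "incseq (\<lambda>K \<omega>. ennreal (W \<omega> * E \<omega>) * indicator (C K) \<omega>)"
      by (auto simp: incseq_def le_fun_def C_def indicator_def intro: order_trans)
  qed measurable
  also have "\<dots> \<le> (\<integral>\<^sup>+\<omega>. ennreal (W \<omega>) \<partial>M)"
    by (intro SUP_least truncated)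
  finally show ?thesis
    by (simp add: E_def)
qed

text \<open>Transfers entrywise conditional moments to a projection: over coordinates for its mean,
  over pairs of coordinates for its second moment.\<close>

lemma (in finite_measure_subalgebra) real_cond_exp_lincomb:
  fixes c :: "'i \<Rightarrow> real"
  assumes "finite I"
    and "\<And>i. i \<in> I \<Longrightarrow> integrable M (f i)"
    and "\<And>i. i \<in> I \<Longrightarrow> AE x in M. real_cond_exp M F (f i) x = g i x"
  shows "AE x in M. real_cond_exp M F (\<lambda>x. \<Sum>i\<in>I. c i * f i x) x = (\<Sum>i\<in>I. c i * g i x)"
  using assms
proof (induction I rule: finite_induct)
  case empty
  then show ?case
    using real_cond_exp_F_meas[of "\<lambda>_. 0"] by simp
next
  case (insert i I)
  have "AE x in M. real_cond_exp M F (\<lambda>x. c i * f i x + (\<Sum>i\<in>I. c i * f i x)) x =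
      real_cond_exp M F (\<lambda>x. c i * f i x) x + real_cond_exp M F (\<lambda>x. \<Sum>i\<in>I. c i * f i x) x"
    using insert.prems by (intro real_cond_exp_add) auto
  moreover have "AE x in M. real_cond_exp M F (\<lambda>x. c i * f i x) x = c i * real_cond_exp M F (f i) x"
    using insert.prems by (intro real_cond_exp_cmult) auto
  moreover have "AE x in M. real_cond_exp M F (\<lambda>x. \<Sum>i\<in>I. c i * f i x) x = (\<Sum>i\<in>I. c i * g i x)"
    using insert.prems by (intro insert.IH) auto
  moreover have "AE x in M. real_cond_exp M F (f i) x = g i x"
    using insert.prems by auto
  ultimately show ?case
    using insert.hyps by auto
qed

section \<open>Measurability: operator norm, trace and natural filtration\<close>

text \<open>Triangle inequality and homogeneity. Convexity is the route to continuity, and thereby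
  to Borel measurability, of the operator norm in \<open>w_fun\<close>.\<close>

lemma convex_onorm_matrix:
  "convex_on UNIV (\<lambda>A::real ^ 'n ^ 'm. onorm ((*v) A))"
proof (rule convex_onI)
  fix t :: real and A B :: "real ^ 'n ^ 'm"
  assume t: "0 < t" "t < 1"
  have "(*v) ((1 - t) *\<^sub>R A + t *\<^sub>R B) = (\<lambda>x. (1 - t) *\<^sub>R (A *v x) + t *\<^sub>R (B *v x))"
    by (auto simp: matrix_vector_mult_add_rdistrib scaleR_matrix_vector_assoc)
  then have "onorm ((*v) ((1 - t) *\<^sub>R A + t *\<^sub>R B)) \<le>
      onorm (\<lambda>x. (1 - t) *\<^sub>R (A *v x)) + onorm (\<lambda>x. t *\<^sub>R (B *v x))"
    by (auto intro!: onorm_triangle bounded_linear_scaleR_right bounded_linear_compose[OF bounded_linear_scaleR_right])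
  also have "\<dots> = (1 - t) * onorm ((*v) A) + t * onorm ((*v) B)"
    using t by (simp add: onorm_scaleR)
  finally show "onorm ((*v) ((1 - t) *\<^sub>R A + t *\<^sub>R B)) \<le> (1 - t) * onorm ((*v) A) + t * onorm ((*v) B)" .
qed simp

lemma borel_measurable_w_fun [measurable]:
  "w_fun \<beta> \<in> borel_measurable (borel :: (real ^ 'd ^ 'd) measure)"
proof -
  have [measurable]: "(\<lambda>A::real ^ 'd ^ 'd. onorm ((*v) A)) \<in> borel_measurable borel"
    using convex_onorm_matrix
    by (intro borel_measurable_continuous_onI convex_on_continuous) auto
  have [measurable]: "(\<lambda>A::real ^ 'd ^ 'd. trace A) \<in> borel_measurable borel"
    unfolding trace_def by (intro borel_measurable_continuous_onI continuous_intros)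
  show ?thesis
    unfolding w_fun_def by measurable
qed

lemma sets_nat_filt:
  "sets (nat_filt M X t) =
    sigma_sets (space M) (\<Union>i\<in>{1..t}. {X i -` B \<inter> space M | B. B \<in> sets borel})"
  unfolding nat_filt_def by (rule sets_measure_of) auto

lemma subalgebra_nat_filt:
  assumes "\<And>i. i \<ge> 1 \<Longrightarrow> X i \<in> borel_measurable M"
  shows "subalgebra M (nat_filt M X t)"
  unfolding subalgebra_def sets_nat_filt
  using assms by (auto intro!: sets.sigma_sets_subset measurable_sets)

lemma sets_nat_filt_mono: "s \<le> t \<Longrightarrow> sets (nat_filt M X s) \<subseteq> sets (nat_filt M X t)"
  unfolding sets_nat_filt by (intro sigma_sets_mono') fastforce

lemma measurable_nat_filt:
  assumes "1 \<le> i" "i \<le> t"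
  shows "X i \<in> borel_measurable (nat_filt M X t)"
proof (rule measurableI)
  fix A :: "'b set"
  assume "A \<in> sets borel"
  then have "X i -` A \<inter> space M \<in> {X i -` B \<inter> space M | B. B \<in> sets borel}"
    by blast
  then have "X i -` A \<inter> space M \<in> (\<Union>i\<in>{1..t}. {X i -` B \<inter> space M | B. B \<in> sets borel})"
    using assms by (intro UN_I[of i]) auto
  then show "X i -` A \<inter> space (nat_filt M X t) \<in> sets (nat_filt M X t)"
    unfolding sets_nat_filt space_nat_filt by (rule sigma_sets.Basic)
qed simp

section \<open>From a bounded Gaussian mixture to a bound on the norm\<close>

definition quad_form :: "real ^ 'd ^ 'd \<Rightarrow> ('d \<Rightarrow> real) \<Rightarrow> real" where
  "quad_form A \<theta> = (\<Sum>j\<in>UNIV. \<Sum>k\<in>UNIV. A $ j $ k * (\<theta> j * \<theta> k))"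

text \<open>The logarithm of the factor gained in one step in direction \<theta>, with weight
  \<open>l\<close>, centred observation \<open>z\<close> and conditional covariance
  \<open>A\<close>. The direction is a function of the index because it is drawn from
  \<open>gauss_measure\<close>.\<close>

definition log_increment ::
  "real \<Rightarrow> real ^ 'd \<Rightarrow> real ^ 'd ^ 'd \<Rightarrow> ('d \<Rightarrow> real) \<Rightarrow> real" where
  "log_increment l z A \<theta> =
    l * (\<Sum>j\<in>UNIV. \<theta> j * z $ j) - (l * (\<Sum>j\<in>UNIV. \<theta> j * z $ j))\<^sup>2 / 6 - l\<^sup>2 * quad_form A \<theta> / 3"

lemma borel_measurable_vec_nth_comp [measurable (raw)]:
  fixes x :: "'a \<Rightarrow> ('b::topological_space) ^ 'n"
  assumes [measurable]: "x \<in> borel_measurable N"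
  shows "(\<lambda>a. x a $ i) \<in> borel_measurable N"
proof -
  have [measurable]: "(\<lambda>y::'b ^ 'n. y $ i) \<in> borel_measurable borel"
    by (intro borel_measurable_continuous_onI continuous_intros)
  show ?thesis by measurable
qed

lemma borel_measurable_quad_form [measurable (raw)]:
  assumes [measurable]: "A \<in> borel_measurable N" "\<And>j. (\<lambda>a. \<theta> a j) \<in> borel_measurable N"
  shows "(\<lambda>a. quad_form (A a) (\<theta> a)) \<in> borel_measurable N"
  unfolding quad_form_def by measurable

text \<open>The direction may vary with the point too: over a product space this yields the joint
  measurability that Fubini requires.\<close>

lemma borel_measurable_log_increment:
  assumes [measurable]: "l \<in> borel_measurable N" "z \<in> borel_measurable N"
    "A \<in> borel_measurable N" "\<And>j. (\<lambda>a. \<theta> a j) \<in> borel_measurable N"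
  shows "(\<lambda>a. log_increment (l a) (z a) (A a) (\<theta> a)) \<in> borel_measurable N"
  unfolding log_increment_def by measurable

lemma quad_form_le_onorm:
  fixes A :: "real ^ 'd ^ 'd" and u :: "real ^ 'd"
  assumes "norm u \<le> 1"
  shows "quad_form A (($) u) \<le> onorm ((*v) A)"
proof -
  have "quad_form A (($) u) = u \<bullet> (A *v u)"
    by (simp add: quad_form_def inner_vec_def matrix_vector_mult_def sum_distrib_left mult_ac)
  also have "\<dots> \<le> norm u * norm (A *v u)"
    by (rule norm_cauchy_schwarz)
  also have "\<dots> \<le> norm u * (onorm ((*v) A) * norm u)"
    by (intro mult_left_mono onorm matrix_vector_mul_bounded_linear) auto
  also have "\<dots> \<le> 1 * (onorm ((*v) A) * 1)"
    using assms
    by (intro mult_mono mult_left_mono mult_nonneg_nonneg onorm_pos_le matrix_vector_mul_bounded_linear) auto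
  finally show ?thesis by simp
qed

text \<open>Purely deterministic. The mixture does not depend on a direction, so its lower bound may
  be evaluated at a \<open>u\<close> chosen after seeing the data. Comparison with \<open>K\<close>
  and taking logarithms isolates the norm of the weighted sum.\<close>

lemma gauss_mixture_imp_norm_bound:
  fixes l :: "nat \<Rightarrow> real" and z :: "nat \<Rightarrow> real ^ 'd" and A :: "nat \<Rightarrow> real ^ 'd ^ 'd"
  assumes "\<beta> > 0" "K > 0"
    and mix: "(\<integral>\<^sup>+\<theta>. ennreal (exp (\<Sum>i\<in>I. log_increment (l i) (z i) (A i) \<theta>))
      \<partial>gauss_measure \<beta> (\<lambda>_. 0)) \<le> ennreal K"
  shows "norm (\<Sum>i\<in>I. l i *\<^sub>R z i) \<le>
    (\<Sum>i\<in>I. (l i)\<^sup>2 * ((1 + 1 / \<beta>) * (norm (z i))\<^sup>2 + 2 * w_fun \<beta> (A i))) / 6 + \<beta> / 2 + ln K"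
proof -
  define S where "S = (\<Sum>i\<in>I. l i *\<^sub>R z i)"
  \<comment> \<open>The direction aligned with \<open>S\<close>. It is 0 when \<open>S\<close> is,
    hence only \<open>norm u \<le> 1\<close> is available, which suffices below.\<close>
  define u where "u = sgn S"
  define a where "a = (\<lambda>j. \<Sum>i\<in>I. l i * z i $ j)"
  \<comment> \<open>With \<open>a\<close> and \<open>Q\<close> the total exponent is one linear form
    minus one quadratic form in \<theta>, the shape required by the mixture lower bound.\<close>
  define Q where "Q = (\<lambda>j k. \<Sum>i\<in>I. (l i)\<^sup>2 * (z i $ j * z i $ k / 6 + A i $ j $ k / 3))"
  have u_le: "norm u \<le> 1"
    by (simp add: u_def norm_sgn)
  have square: "(\<Sum>j\<in>UNIV. \<theta> j * y $ j)\<^sup>2 = (\<Sum>j\<in>UNIV. \<Sum>k\<in>UNIV. y $ j * y $ k * (\<theta> j * \<theta> k))"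
    for \<theta> and y :: "real ^ 'd"
    by (simp add: power2_eq_square sum_product mult_ac)
  have Q_form: "(\<Sum>j\<in>UNIV. \<Sum>k\<in>UNIV. Q j k * (\<theta> j * \<theta> k)) =
      (\<Sum>i\<in>I. (l i)\<^sup>2 * ((\<Sum>j\<in>UNIV. \<theta> j * z i $ j)\<^sup>2 / 6 + quad_form (A i) \<theta> / 3))" for \<theta>
  proof -
    have "(\<Sum>j\<in>UNIV. \<Sum>k\<in>UNIV. Q j k * (\<theta> j * \<theta> k)) =
        (\<Sum>j\<in>UNIV. \<Sum>k\<in>UNIV. \<Sum>i\<in>I.
          (l i)\<^sup>2 * (z i $ j * z i $ k * (\<theta> j * \<theta> k) / 6 + A i $ j $ k * (\<theta> j * \<theta> k) / 3))"
      unfolding Q_def sum_distrib_right by (intro sum.cong refl) (simp add: algebra_simps)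
    also have "\<dots> = (\<Sum>j\<in>UNIV. \<Sum>i\<in>I. \<Sum>k\<in>UNIV.
          (l i)\<^sup>2 * (z i $ j * z i $ k * (\<theta> j * \<theta> k) / 6 + A i $ j $ k * (\<theta> j * \<theta> k) / 3))"
      by (intro sum.cong refl sum.swap)
    also have "\<dots> = (\<Sum>i\<in>I. \<Sum>j\<in>UNIV. \<Sum>k\<in>UNIV.
          (l i)\<^sup>2 * (z i $ j * z i $ k * (\<theta> j * \<theta> k) / 6 + A i $ j $ k * (\<theta> j * \<theta> k) / 3))"
      by (rule sum.swap)
    also have "\<dots> = (\<Sum>i\<in>I. (l i)\<^sup>2 * ((\<Sum>j\<in>UNIV. \<theta> j * z i $ j)\<^sup>2 / 6 + quad_form (A i) \<theta> / 3))"
      unfolding square quad_form_def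
      by (simp add: sum_distrib_left[symmetric] sum.distrib sum_divide_distrib[symmetric])
    finally show ?thesis .
  qed
  have a_form: "(\<Sum>j\<in>UNIV. a j * \<theta> j) = (\<Sum>i\<in>I. l i * (\<Sum>j\<in>UNIV. \<theta> j * z i $ j))" for \<theta>
    unfolding a_def sum_distrib_left sum_distrib_right
    by (subst sum.swap) (simp add: mult_ac)
  have log_form: "(\<Sum>i\<in>I. log_increment (l i) (z i) (A i) \<theta>) =
      (\<Sum>j\<in>UNIV. a j * \<theta> j) - (\<Sum>j\<in>UNIV. \<Sum>k\<in>UNIV. Q j k * (\<theta> j * \<theta> k))" for \<theta>
    unfolding Q_form a_form log_increment_def sum_subtractf[symmetric]
    by (intro sum.cong refl) (simp add: algebra_simps)
  let ?m = "(\<Sum>j\<in>UNIV. a j * u $ j) - (\<Sum>j\<in>UNIV. \<Sum>k\<in>UNIV. Q j k * (u $ j * u $ k))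
        - (\<Sum>j\<in>UNIV. Q j j) / \<beta> - \<beta> * (\<Sum>j\<in>UNIV. (u $ j)\<^sup>2) / 2"
  have "ennreal (exp ?m) \<le> ennreal K"
    using gauss_mixture_lower_bound[OF \<open>\<beta> > 0\<close>, of a "($) u" Q] mix
    unfolding log_form by (rule order_trans)
  then have "exp ?m \<le> K"
    using \<open>K > 0\<close> by simp
  then have m_le: "?m \<le> ln K"
    using \<open>K > 0\<close> by (simp add: ln_ge_iff)
  have a_u: "(\<Sum>j\<in>UNIV. a j * u $ j) = norm S"
  proof -
    have "(\<Sum>j\<in>UNIV. a j * u $ j) = S \<bullet> u"
      by (simp add: inner_vec_def S_def a_def)
    also have "\<dots> = norm S"
      by (cases "S = 0") (simp_all add: u_def sgn_div_norm dot_square_norm power2_eq_square)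
    finally show ?thesis .
  qed
  have u_sq: "(\<Sum>j\<in>UNIV. (u $ j)\<^sup>2) \<le> 1"
    using u_le by (simp add: norm_vec_def L2_set_def)
  have Q_trace: "(\<Sum>j\<in>UNIV. Q j j) = (\<Sum>i\<in>I. (l i)\<^sup>2 * ((norm (z i))\<^sup>2 / 6 + trace (A i) / 3))"
  proof -
    have "(\<Sum>j\<in>UNIV. Q j j) =
        (\<Sum>i\<in>I. \<Sum>j\<in>UNIV. (l i)\<^sup>2 * (z i $ j * z i $ j / 6 + A i $ j $ j / 3))"
      unfolding Q_def by (rule sum.swap)
    also have "\<dots> = (\<Sum>i\<in>I. (l i)\<^sup>2 * ((norm (z i))\<^sup>2 / 6 + trace (A i) / 3))"
      by (simp add: sum_distrib_left[symmetric] sum.distrib sum_divide_distrib[symmetric]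
          trace_def power2_norm_eq_inner inner_vec_def)
    finally show ?thesis .
  qed
  have "norm S \<le> (\<Sum>j\<in>UNIV. \<Sum>k\<in>UNIV. Q j k * (u $ j * u $ k)) + (\<Sum>j\<in>UNIV. Q j j) / \<beta>
      + \<beta> * 1 / 2 + ln K"
  proof -
    have "\<beta> * (\<Sum>j\<in>UNIV. (u $ j)\<^sup>2) / 2 \<le> \<beta> * 1 / 2"
      using u_sq \<open>\<beta> > 0\<close> by (intro divide_right_mono mult_left_mono) auto
    then show ?thesis
      using m_le a_u by linarith
  qed
  also have "(\<Sum>j\<in>UNIV. \<Sum>k\<in>UNIV. Q j k * (u $ j * u $ k)) + (\<Sum>j\<in>UNIV. Q j j) / \<beta> =
      (\<Sum>i\<in>I. (l i)\<^sup>2 * ((\<Sum>j\<in>UNIV. u $ j * z i $ j)\<^sup>2 / 6 + quad_form (A i) (($) u) / 3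
        + ((norm (z i))\<^sup>2 / 6 + trace (A i) / 3) / \<beta>))"
    unfolding Q_form Q_trace sum_divide_distrib sum.distrib[symmetric]
    by (intro sum.cong refl) (simp add: algebra_simps add_divide_distrib)
  \<comment> \<open>The value at \<open>u\<close> contributes the 1 in
    \<open>1 + 1 / \<beta>\<close> and the operator norm; the trace of \<open>Q\<close> contributes
    the parts divided by \<beta>. The coefficient 1/3 of the covariance is the 2/6 in front of
    \<open>w_fun\<close>.\<close>
  also have "\<dots> \<le> (\<Sum>i\<in>I. (l i)\<^sup>2 * ((1 + 1 / \<beta>) * (norm (z i))\<^sup>2 + 2 * w_fun \<beta> (A i)) / 6)"
  proof (rule sum_mono)
    fix i
    have "\<bar>u \<bullet> z i\<bar> \<le> norm u * norm (z i)"
      by (rule Cauchy_Schwarz_ineq2)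
    also have "\<dots> \<le> norm (z i)"
      using u_le by (simp add: mult_left_le_one_le)
    finally have "(u \<bullet> z i)\<^sup>2 \<le> (norm (z i))\<^sup>2"
      by (simp add: abs_le_square_iff[symmetric])
    then have "(\<Sum>j\<in>UNIV. u $ j * z i $ j)\<^sup>2 / 6 + quad_form (A i) (($) u) / 3
        + ((norm (z i))\<^sup>2 / 6 + trace (A i) / 3) / \<beta> \<le>
        (norm (z i))\<^sup>2 / 6 + onorm ((*v) (A i)) / 3 + ((norm (z i))\<^sup>2 / 6 + trace (A i) / 3) / \<beta>"
      using quad_form_le_onorm[OF u_le, of "A i"] by (simp add: inner_vec_def)
    also have "\<dots> = ((1 + 1 / \<beta>) * (norm (z i))\<^sup>2 + 2 * w_fun \<beta> (A i)) / 6"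
      using \<open>\<beta> > 0\<close> by (simp add: w_fun_def field_simps)
    finally show "(l i)\<^sup>2 * ((\<Sum>j\<in>UNIV. u $ j * z i $ j)\<^sup>2 / 6 + quad_form (A i) (($) u) / 3
        + ((norm (z i))\<^sup>2 / 6 + trace (A i) / 3) / \<beta>) \<le>
        (l i)\<^sup>2 * ((1 + 1 / \<beta>) * (norm (z i))\<^sup>2 + 2 * w_fun \<beta> (A i)) / 6"
      unfolding times_divide_eq_right[symmetric] by (intro mult_left_mono) auto
  qed
  finally show ?thesis
    by (simp add: S_def sum_divide_distrib)
qed

section \<open>Consequences of the conditional moment assumptions\<close>

text \<open>Integrate the conditional bound and use the tower property. The nonnegative conditional
  expectation does not presuppose integrability, so finiteness is a genuine conclusion.\<close>

lemma nn_cond_exp_bound_integrable: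
  fixes X :: "'w \<Rightarrow> real ^ 'd"
  assumes "prob_space M" "subalgebra M F" and [measurable]: "X \<in> borel_measurable M"
    and bound: "AE \<omega> in M. nn_cond_exp M F (\<lambda>\<omega>'. ennreal ((norm (X \<omega>'))\<^sup>2)) \<omega> \<le> ennreal (v\<^sup>2)"
  shows "integrable M (\<lambda>\<omega>. (norm (X \<omega>))\<^sup>2)" and "(\<integral>\<omega>. (norm (X \<omega>))\<^sup>2 \<partial>M) \<le> v\<^sup>2"
proof -
  interpret prob_space M by fact
  interpret finite_measure_subalgebra M F
    using assms by unfold_locales
  have "(\<integral>\<^sup>+\<omega>. ennreal ((norm (X \<omega>))\<^sup>2) \<partial>M) =
      (\<integral>\<^sup>+\<omega>. nn_cond_exp M F (\<lambda>\<omega>'. ennreal ((norm (X \<omega>'))\<^sup>2)) \<omega> \<partial>M)"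
    using nn_cond_exp_intg[of "\<lambda>_. 1" "\<lambda>\<omega>. ennreal ((norm (X \<omega>))\<^sup>2)"] by simp
  also have "\<dots> \<le> (\<integral>\<^sup>+\<omega>. ennreal (v\<^sup>2) \<partial>M)"
    by (rule nn_integral_mono_AE[OF bound])
  also have "\<dots> = ennreal (v\<^sup>2)"
    by (simp add: emeasure_space_1)
  finally have le: "(\<integral>\<^sup>+\<omega>. ennreal ((norm (X \<omega>))\<^sup>2) \<partial>M) \<le> ennreal (v\<^sup>2)" .
  then have "(\<integral>\<^sup>+\<omega>. ennreal ((norm (X \<omega>))\<^sup>2) \<partial>M) < \<infinity>"
    using le_less_trans ennreal_less_top by (metis infinity_ennreal_def)
  then show "integrable M (\<lambda>\<omega>. (norm (X \<omega>))\<^sup>2)"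
    by (intro integrableI_bounded) auto
  then show "(\<integral>\<omega>. (norm (X \<omega>))\<^sup>2 \<partial>M) \<le> v\<^sup>2"
    using le by (simp add: nn_integral_eq_integral)
qed

text \<open>A coordinate is dominated by one plus the squared norm, a product of two coordinates by
  the squared norm; the centred product expands into these.\<close>

lemma integrable_centred_products:
  fixes X :: "'w \<Rightarrow> real ^ 'd"
  assumes "prob_space M" and [measurable]: "X \<in> borel_measurable M"
    and "integrable M (\<lambda>\<omega>. (norm (X \<omega>))\<^sup>2)"
  shows "integrable M (\<lambda>\<omega>. X \<omega> $ j)"
    and "integrable M (\<lambda>\<omega>. (X \<omega> - \<mu>) $ j * (X \<omega> - \<mu>) $ k)"
proof -
  interpret prob_space M by fact
  have comp: "integrable M (\<lambda>\<omega>. X \<omega> $ i)" for i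
  proof (rule Bochner_Integration.integrable_bound)
    show "integrable M (\<lambda>\<omega>. 1 + (norm (X \<omega>))\<^sup>2)"
      using assms by simp
    have "\<bar>x $ i\<bar> \<le> 1 + (norm x)\<^sup>2" for x :: "real ^ 'd"
      using component_le_norm_cart[of x i] sum_squares_bound[of 1 "norm x"] by simp
    then show "AE \<omega> in M. norm (X \<omega> $ i) \<le> norm (1 + (norm (X \<omega>))\<^sup>2)"
      by (auto intro: order_trans)
  qed measurable
  then show "integrable M (\<lambda>\<omega>. X \<omega> $ j)" .
  have prod: "integrable M (\<lambda>\<omega>. X \<omega> $ j * X \<omega> $ k)"
  proof (rule Bochner_Integration.integrable_bound[OF assms(3)])
    show "AE \<omega> in M. norm (X \<omega> $ j * X \<omega> $ k) \<le> norm ((norm (X \<omega>))\<^sup>2)"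
      by (auto simp: abs_mult power2_eq_square intro!: mult_mono component_le_norm_cart)
  qed measurable
  have "(\<lambda>\<omega>. (X \<omega> - \<mu>) $ j * (X \<omega> - \<mu>) $ k) =
      (\<lambda>\<omega>. X \<omega> $ j * X \<omega> $ k - \<mu> $ k * X \<omega> $ j - \<mu> $ j * X \<omega> $ k + \<mu> $ j * \<mu> $ k)"
    by (auto simp: algebra_simps)
  then show "integrable M (\<lambda>\<omega>. (X \<omega> - \<mu>) $ j * (X \<omega> - \<mu>) $ k)"
    using comp prod by simp
qed

text \<open>The squared norm of \<mu> is the expectation of
  \<open>\<mu> \<bullet> X \<omega>\<close>, which Cauchy-Schwarz and the arithmetic-geometric mean
  bound by \<open>((norm \<mu>)\<^sup>2 + v\<^sup>2) / 2\<close>. This is what lets \<open>v\<close>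
  replace the unknown mean in \<open>s_fun\<close>.\<close>

lemma norm_cond_mean_le:
  fixes X :: "'w \<Rightarrow> real ^ 'd"
  assumes "prob_space M" "subalgebra M F" "X \<in> borel_measurable M" "v > 0"
    and mean: "AE \<omega> in M. vec_cond_exp M F X \<omega> = \<mu>"
    and bound: "AE \<omega> in M. nn_cond_exp M F (\<lambda>\<omega>'. ennreal ((norm (X \<omega>'))\<^sup>2)) \<omega> \<le> ennreal (v\<^sup>2)"
  shows "norm \<mu> \<le> v"
proof -
  interpret prob_space M by fact
  interpret finite_measure_subalgebra M F
    using assms by unfold_locales
  note sq = nn_cond_exp_bound_integrable[OF assms(1-3) bound]
  note comp = integrable_centred_products(1)[OF assms(1,3) sq(1)]
  have E: "(\<integral>\<omega>. X \<omega> $ j \<partial>M) = \<mu> $ j" for j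
  proof -
    have "AE \<omega> in M. real_cond_exp M F (\<lambda>\<omega>'. X \<omega>' $ j) \<omega> = \<mu> $ j"
      using mean by eventually_elim (auto simp: vec_cond_exp_def)
    then have "(\<integral>\<omega>. real_cond_exp M F (\<lambda>\<omega>'. X \<omega>' $ j) \<omega> \<partial>M) = (\<integral>\<omega>. \<mu> $ j \<partial>M)"
      by (intro integral_cong_AE) auto
    then show ?thesis
      using real_cond_exp_int(2)[OF comp[of j]] by (simp add: prob_space)
  qed
  have "(norm \<mu>)\<^sup>2 = (\<Sum>j\<in>UNIV. \<mu> $ j * (\<integral>\<omega>. X \<omega> $ j \<partial>M))"
    by (simp add: E power2_norm_eq_inner inner_vec_def)
  also have "\<dots> = (\<integral>\<omega>. \<mu> \<bullet> X \<omega> \<partial>M)"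
    using comp by (simp add: inner_vec_def)
  also have "\<dots> \<le> (\<integral>\<omega>. ((norm \<mu>)\<^sup>2 + (norm (X \<omega>))\<^sup>2) / 2 \<partial>M)"
  proof (rule integral_mono)
    show "integrable M (\<lambda>\<omega>. \<mu> \<bullet> X \<omega>)"
      using comp by (simp add: inner_vec_def)
    fix \<omega>
    have "\<mu> \<bullet> X \<omega> \<le> norm \<mu> * norm (X \<omega>)"
      by (rule norm_cauchy_schwarz)
    then show "\<mu> \<bullet> X \<omega> \<le> ((norm \<mu>)\<^sup>2 + (norm (X \<omega>))\<^sup>2) / 2"
      using sum_squares_bound[of "norm \<mu>" "norm (X \<omega>)"] by simp
  qed (use sq in simp)
  also have "\<dots> \<le> ((norm \<mu>)\<^sup>2 + v\<^sup>2) / 2"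
    using sq by (simp add: prob_space)
  finally have "(norm \<mu>)\<^sup>2 \<le> v\<^sup>2"
    by simp
  then show ?thesis
    using \<open>v > 0\<close> by (simp add: power2_le_iff_abs_le)
qed

text \<open>Project on \<theta> and apply the scalar step: the projection has conditional mean 0 and
  conditional second moment \<open>quad_form (\<Sigma> \<omega>) \<theta>\<close>. Conditional
  covariances are determined only almost everywhere, so \<Sigma> is any \<open>F\<close>-measurable
  version.\<close>

lemma vector_supermartingale_step:
  fixes X :: "'w \<Rightarrow> real ^ 'd" and \<Sigma> :: "'w \<Rightarrow> real ^ 'd ^ 'd"
  assumes "prob_space M" "subalgebra M F" and X_meas [measurable]: "X \<in> borel_measurable M"
    and mean: "AE \<omega> in M. vec_cond_exp M F X \<omega> = \<mu>"
    and sq: "integrable M (\<lambda>\<omega>. (norm (X \<omega>))\<^sup>2)"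
    and F_meas [measurable]: "\<Sigma> \<in> borel_measurable F" "l \<in> borel_measurable F" "W \<in> borel_measurable F"
    and cov: "AE \<omega> in M. \<Sigma> \<omega> = cond_cov M F X \<mu> \<omega>"
    and W_nonneg: "\<And>\<omega>. W \<omega> \<ge> 0"
  shows "(\<integral>\<^sup>+\<omega>. ennreal (W \<omega> * exp (log_increment (l \<omega>) (X \<omega> - \<mu>) (\<Sigma> \<omega>) \<theta>)) \<partial>M)
    \<le> (\<integral>\<^sup>+\<omega>. ennreal (W \<omega>) \<partial>M)"
proof -
  interpret prob_space M by fact
  interpret finite_measure_subalgebra M F
    using assms by unfold_locales
  define Y where "Y = (\<lambda>\<omega>. \<Sum>j\<in>UNIV. \<theta> j * (X \<omega> - \<mu>) $ j)"
  have Y_sq: "(Y \<omega>)\<^sup>2 = (\<Sum>p\<in>UNIV. (\<theta> (fst p) * \<theta> (snd p)) * ((X \<omega> - \<mu>) $ fst p * (X \<omega> - \<mu>) $ snd p))"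
    for \<omega>
    by (simp add: Y_def power2_eq_square sum_product sum.cartesian_product case_prod_beta mult_ac)
  have quad: "quad_form A \<theta> = (\<Sum>p\<in>UNIV. (\<theta> (fst p) * \<theta> (snd p)) * A $ fst p $ snd p)"
    for A :: "real ^ 'd ^ 'd"
    by (simp add: quad_form_def sum.cartesian_product case_prod_beta mult_ac)
  have comp: "integrable M (\<lambda>\<omega>. X \<omega> $ j)" for j
    by (rule integrable_centred_products(1)[OF assms(1) X_meas sq])
  have prod: "integrable M (\<lambda>\<omega>. (X \<omega> - \<mu>) $ j * (X \<omega> - \<mu>) $ k)" for j k
    by (rule integrable_centred_products(2)[OF assms(1) X_meas sq])
  have Y_mean: "AE \<omega> in M. real_cond_exp M F Y \<omega> = (\<Sum>j\<in>UNIV. \<theta> j * 0)"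
    unfolding Y_def
  proof (rule real_cond_exp_lincomb)
    fix j
    have "AE \<omega> in M. real_cond_exp M F (\<lambda>\<omega>. X \<omega> $ j - \<mu> $ j) \<omega> =
        real_cond_exp M F (\<lambda>\<omega>. X \<omega> $ j) \<omega> - real_cond_exp M F (\<lambda>\<omega>. \<mu> $ j) \<omega>"
      using comp by (intro real_cond_exp_diff) auto
    moreover have "AE \<omega> in M. real_cond_exp M F (\<lambda>\<omega>. \<mu> $ j) \<omega> = \<mu> $ j"
      by (intro real_cond_exp_F_meas) auto
    ultimately show "AE \<omega> in M. real_cond_exp M F (\<lambda>\<omega>. (X \<omega> - \<mu>) $ j) \<omega> = 0"
      using mean by eventually_elim (auto simp: vec_cond_exp_def)
  qed (use comp in auto)
  have Y_var: "AE \<omega> in M. real_cond_exp M F (\<lambda>\<omega>. (Y \<omega>)\<^sup>2) \<omega> = quad_form (\<Sigma> \<omega>) \<theta>"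
    unfolding Y_sq quad
  proof (rule real_cond_exp_lincomb)
    fix p :: "'d \<times> 'd"
    show "AE \<omega> in M. real_cond_exp M F (\<lambda>\<omega>. (X \<omega> - \<mu>) $ fst p * (X \<omega> - \<mu>) $ snd p) \<omega> =
        \<Sigma> \<omega> $ fst p $ snd p"
      using cov by eventually_elim (simp add: cond_cov_def mat_cond_exp_def outer_prod_def)
  qed (use prod in auto)
  have [measurable]: "(\<lambda>\<omega>. quad_form (\<Sigma> \<omega>) \<theta>) \<in> borel_measurable F"
    by measurable
  have "integrable M Y"
    using comp unfolding Y_def by simp
  moreover have "integrable M (\<lambda>\<omega>. (Y \<omega>)\<^sup>2)"
    using prod unfolding Y_sq by simp
  ultimately show ?thesis
    using delyon_supermartingale_step[of F Y "\<lambda>\<omega>. quad_form (\<Sigma> \<omega>) \<theta>" l W] assms(2) Y_mean Y_var W_nonneg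
    by (simp add: log_increment_def Y_def)
qed

section \<open>The mixture supermartingale and the time-uniform bound\<close>

theorem theorem3p2:
  fixes M :: "'w measure"
    and X :: "nat \<Rightarrow> 'w \<Rightarrow> real ^ 'd"
    and \<mu> :: "real ^ 'd"
    and \<Sigma> :: "nat \<Rightarrow> 'w \<Rightarrow> real ^ 'd ^ 'd"
    and lam :: "nat \<Rightarrow> 'w \<Rightarrow> real"
    and v \<beta> \<alpha> :: real
  assumes "prob_space M"
    and "v > 0"
    and "\<And>t. t \<ge> 1 \<Longrightarrow> X t \<in> borel_measurable M"
    and "\<And>t. t \<ge> 1 \<Longrightarrow> AE \<omega> in M. vec_cond_exp M (nat_filt M X (t - 1)) (X t) \<omega> = \<mu>"
    and "\<And>t. t \<ge> 1 \<Longrightarrow> AE \<omega> in M.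
           nn_cond_exp M (nat_filt M X (t - 1)) (\<lambda>\<omega>'. ennreal ((norm (X t \<omega>'))\<^sup>2)) \<omega>
             \<le> ennreal (v\<^sup>2)"
    and "\<And>t. t \<ge> 1 \<Longrightarrow> \<Sigma> t \<in> borel_measurable (nat_filt M X (t - 1))"
    and "\<And>t. t \<ge> 1 \<Longrightarrow> AE \<omega> in M. \<Sigma> t \<omega> = cond_cov M (nat_filt M X (t - 1)) (X t) \<mu> \<omega>"
    and "predictable (nat_filt M X) lam"
    and "\<And>t \<omega>. t \<ge> 1 \<Longrightarrow> \<omega> \<in> space M \<Longrightarrow> lam t \<omega> > 0"
    and "\<beta> > 0"
    and "0 < \<alpha>" and "\<alpha> < 1"
  shows "measure M {\<omega> \<in> space M. \<forall>t\<ge>1.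
           norm ((\<Sum>i=1..t. lam i \<omega> *\<^sub>R X i \<omega>) /\<^sub>R (\<Sum>i=1..t. lam i \<omega>) - \<mu>)
             \<le> (\<Sum>i=1..t. (lam i \<omega>)\<^sup>2 * (s_fun v \<beta> (X i \<omega>) + 2 * w_fun \<beta> (\<Sigma> i \<omega>)))
                 / (6 * (\<Sum>i=1..t. lam i \<omega>))
               + (\<beta> / 2 + ln (1 / \<alpha>)) / (\<Sum>i=1..t. lam i \<omega>)} \<ge> 1 - \<alpha>"
proof -
  interpret prob_space M by fact
  define F where "F = nat_filt M X"
  define P where "P = gauss_measure \<beta> (\<lambda>_::'d. 0)"
  define f where "f = (\<lambda>t \<omega> \<theta>. \<Sum>i\<in>{1..t}. log_increment (lam i \<omega>) (X i \<omega> - \<mu>) (\<Sigma> i \<omega>) \<theta>)"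
  define G where "G = (\<lambda>t \<omega>. \<integral>\<^sup>+\<theta>. ennreal (exp (f t \<omega> \<theta>)) \<partial>P)"
  interpret P: prob_space P
    unfolding P_def by (rule prob_space_gauss_measure) fact
  interpret PM: pair_sigma_finite M P ..
  have sets_P [measurable_cong]: "sets P = sets (PiM UNIV (\<lambda>_. borel))"
    unfolding P_def by (rule sets_gauss_measure)
  have sub: "subalgebra M (F t)" for t
    unfolding F_def using assms(3) by (rule subalgebra_nat_filt)
  have sub_F: "subalgebra (F t) (F s)" if "s \<le> t" for s t
    using sets_nat_filt_mono[OF that, of M X] by (simp add: subalgebra_def F_def)
  \<comment> \<open>Predictability read one step ahead: the weight of step \<open>Suc t\<close> is
    already known at time \<open>t\<close>.\<close>
  have lam_F: "lam (Suc t) \<in> borel_measurable (F t)" for t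
    using assms(8) unfolding predictable_def F_def
    by (metis diff_Suc_1 le_add1 plus_1_eq_Suc)
  have Sig_F: "\<Sigma> (Suc t) \<in> borel_measurable (F t)" for t
    using assms(6)[of "Suc t"] by (simp add: F_def)
  have X_F: "X i \<in> borel_measurable (F t)" "lam i \<in> borel_measurable (F t)"
    "\<Sigma> i \<in> borel_measurable (F t)" if "i \<in> {1..t}" for i t
  proof -
    obtain s where s: "i = Suc s" "s \<le> t"
      using \<open>i \<in> {1..t}\<close> by (cases i) auto
    show "X i \<in> borel_measurable (F t)"
      unfolding F_def using that by (intro measurable_nat_filt) auto
    show "lam i \<in> borel_measurable (F t)" "\<Sigma> i \<in> borel_measurable (F t)"
      using measurable_from_subalg[OF sub_F[OF s(2)]] lam_F Sig_F s(1) by auto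
  qed
  have X_M: "X i \<in> borel_measurable M" "lam i \<in> borel_measurable M"
    "\<Sigma> i \<in> borel_measurable M" if "i \<in> {1..t}" for i t
    using X_F[OF that] measurable_from_subalg[OF sub] by auto
  have sq: "integrable M (\<lambda>\<omega>. (norm (X t \<omega>))\<^sup>2)" if "t \<ge> 1" for t
    using nn_cond_exp_bound_integrable(1)[OF assms(1) sub assms(3)[OF that] assms(5)[folded F_def, OF that]] .
  have norm_\<mu>: "norm \<mu> \<le> v"
    by (rule norm_cond_mean_le[OF assms(1) sub assms(3)[of 1] assms(2) assms(4,5)[of 1, folded F_def]]) simp_all
  \<comment> \<open>Joint measurability over \<open>F t\<close> makes \<open>G\<close> adapted; the
    version over \<open>M\<close> below serves Fubini.\<close>
  have f_F [measurable]: "(\<lambda>p. f t (fst p) (snd p)) \<in> borel_measurable (F t \<Otimes>\<^sub>M P)" for t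
  proof -
    have "(\<lambda>p. log_increment (lam i (fst p)) (X i (fst p) - \<mu>) (\<Sigma> i (fst p)) (snd p)) \<in>
        borel_measurable (F t \<Otimes>\<^sub>M PiM UNIV (\<lambda>_. borel))" if "i \<in> {1..t}" for i
    proof -
      note [measurable] = X_F[OF that]
      show ?thesis
        by (intro borel_measurable_log_increment) measurable
    qed
    then have "(\<lambda>p. f t (fst p) (snd p)) \<in> borel_measurable (F t \<Otimes>\<^sub>M PiM UNIV (\<lambda>_. borel))"
      unfolding f_def by (intro borel_measurable_sum)
    then show ?thesis
      by (simp add: measurable_cong_sets[OF sets_pair_measure_cong[OF refl sets_P] refl])
  qed
  have f_M [measurable]: "(\<lambda>p. f t (fst p) (snd p)) \<in> borel_measurable (M \<Otimes>\<^sub>M P)" for t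
  proof -
    have "(\<lambda>p. log_increment (lam i (fst p)) (X i (fst p) - \<mu>) (\<Sigma> i (fst p)) (snd p)) \<in>
        borel_measurable (M \<Otimes>\<^sub>M PiM UNIV (\<lambda>_. borel))" if "i \<in> {1..t}" for i
    proof -
      note [measurable] = X_M[OF that]
      show ?thesis
        by (intro borel_measurable_log_increment) measurable
    qed
    then have "(\<lambda>p. f t (fst p) (snd p)) \<in> borel_measurable (M \<Otimes>\<^sub>M PiM UNIV (\<lambda>_. borel))"
      unfolding f_def by (intro borel_measurable_sum)
    then show ?thesis
      by (simp add: measurable_cong_sets[OF sets_pair_measure_cong[OF refl sets_P] refl])
  qed
  have G_F: "G t \<in> borel_measurable (F t)" for t
    unfolding G_def by (rule P.borel_measurable_nn_integral) (simp add: split_beta')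
  have G_super: "(\<integral>\<^sup>+\<omega>\<in>A. G (Suc t) \<omega> \<partial>M) \<le> (\<integral>\<^sup>+\<omega>\<in>A. G t \<omega> \<partial>M)" if A: "A \<in> sets (F t)" for A t
  proof -
    have [measurable]: "A \<in> sets M"
      using A sub by (auto simp: subalgebra_def)
    \<comment> \<open>Exchanging the integrals reduces the supermartingale inequality for the
      mixture to one for each fixed \<theta>.\<close>
    have swap: "(\<integral>\<^sup>+\<omega>\<in>A. G s \<omega> \<partial>M) =
        (\<integral>\<^sup>+\<theta>. \<integral>\<^sup>+\<omega>. ennreal (exp (f s \<omega> \<theta>)) * indicator A \<omega> \<partial>M \<partial>P)" for s
    proof -
      have "(\<integral>\<^sup>+\<omega>\<in>A. G s \<omega> \<partial>M) =
          (\<integral>\<^sup>+\<omega>. \<integral>\<^sup>+\<theta>. ennreal (exp (f s \<omega> \<theta>)) * indicator A \<omega> \<partial>P \<partial>M)"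
      proof (rule nn_integral_cong)
        fix \<omega> assume "\<omega> \<in> space M"
        then have "(\<lambda>\<theta>. f s \<omega> \<theta>) \<in> borel_measurable P"
          using measurable_compose[OF measurable_Pair1' f_M] by simp
        then show "G s \<omega> * indicator A \<omega> = (\<integral>\<^sup>+\<theta>. ennreal (exp (f s \<omega> \<theta>)) * indicator A \<omega> \<partial>P)"
          unfolding G_def by (intro nn_integral_multc[symmetric]) auto
      qed
      also have "\<dots> = (\<integral>\<^sup>+\<theta>. \<integral>\<^sup>+\<omega>. ennreal (exp (f s \<omega> \<theta>)) * indicator A \<omega> \<partial>M \<partial>P)"
        by (rule PM.Fubini'[symmetric]) (simp add: split_beta')
      finally show ?thesis .
    qed
    have "(\<integral>\<^sup>+\<omega>. ennreal (exp (f (Suc t) \<omega> \<theta>)) * indicator A \<omega> \<partial>M) \<le>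
        (\<integral>\<^sup>+\<omega>. ennreal (exp (f t \<omega> \<theta>)) * indicator A \<omega> \<partial>M)" if "\<theta> \<in> space P" for \<theta>
    proof -
      define W where "W = (\<lambda>\<omega>. exp (f t \<omega> \<theta>) * indicator A \<omega>)"
      have "(\<lambda>\<omega>. f t \<omega> \<theta>) \<in> borel_measurable (F t)"
        using measurable_compose[OF measurable_Pair2'[OF that] f_F] by simp
      then have W: "W \<in> borel_measurable (F t)"
        using A unfolding W_def by measurable
      have ge: "Suc t \<ge> 1" by simp
      have "(\<integral>\<^sup>+\<omega>. ennreal (W \<omega> * exp (log_increment (lam (Suc t) \<omega>) (X (Suc t) \<omega> - \<mu>)
          (\<Sigma> (Suc t) \<omega>) \<theta>)) \<partial>M) \<le> (\<integral>\<^sup>+\<omega>. ennreal (W \<omega>) \<partial>M)"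
        using assms(4)[OF ge] assms(7)[OF ge]
        by (intro vector_supermartingale_step[OF assms(1) sub assms(3)[OF ge] _ sq[OF ge] Sig_F lam_F W])
          (auto simp: F_def W_def)
      moreover have "ennreal (exp (f (Suc t) \<omega> \<theta>)) * indicator A \<omega> =
          ennreal (W \<omega> * exp (log_increment (lam (Suc t) \<omega>) (X (Suc t) \<omega> - \<mu>) (\<Sigma> (Suc t) \<omega>) \<theta>))" for \<omega>
        by (simp add: f_def W_def exp_add indicator_def)
      moreover have "ennreal (exp (f t \<omega> \<theta>)) * indicator A \<omega> = ennreal (W \<omega>)" for \<omega>
        by (simp add: W_def indicator_def)
      ultimately show ?thesis by simp
    qed
    then show ?thesis
      unfolding swap by (rule nn_integral_mono)
  qed
  define bad where "bad = {\<omega> \<in> space M. \<exists>t. ennreal (1 / \<alpha>) \<le> G t \<omega>}"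
  have [measurable]: "G t \<in> borel_measurable M" for t
    using measurable_from_subalg[OF sub G_F] .
  have bad_M [measurable]: "bad \<in> sets M"
    unfolding bad_def by measurable
  have "ennreal (1 / \<alpha>) * emeasure M bad \<le> (\<integral>\<^sup>+\<omega>. G 0 \<omega> \<partial>M)"
    unfolding bad_def
    using sub sub_F G_F G_super by (intro ville_inequality[of M F]) (auto simp: subalgebra_def)
  \<comment> \<open>At time 0 the exponent is an empty sum, so \<open>G 0\<close> is the total mass
    of \<open>P\<close>.\<close>
  also have "\<dots> = 1"
    by (simp add: G_def f_def P.emeasure_space_1 emeasure_space_1)
  finally have "ennreal (1 / \<alpha>) * ennreal (prob bad) \<le> 1"
    by (simp add: emeasure_eq_measure)
  then have "ennreal (1 / \<alpha> * prob bad) \<le> ennreal 1"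
    using \<open>0 < \<alpha>\<close> by (subst ennreal_mult) auto
  then have "1 / \<alpha> * prob bad \<le> 1"
    by (subst (asm) ennreal_le_iff) auto
  then have prob_bad: "prob bad \<le> \<alpha>"
    using \<open>0 < \<alpha>\<close> by (simp add: field_simps)
  define num where "num = (\<lambda>t \<omega>. \<Sum>i=1..t. (lam i \<omega>)\<^sup>2 * (s_fun v \<beta> (X i \<omega>) + 2 * w_fun \<beta> (\<Sigma> i \<omega>)))"
  define \<Lambda> where "\<Lambda> = (\<lambda>t \<omega>. \<Sum>i=1..t. lam i \<omega>)"
  \<comment> \<open>The event of the theorem, with a bounded quantifier that suits the measurability
    proof. Measurability is needed for monotonicity, since \<open>measure\<close> is 0 on
    nonmeasurable sets.\<close>
  define good where "good = {\<omega> \<in> space M. \<forall>t\<in>{1..}.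
           norm ((\<Sum>i=1..t. lam i \<omega> *\<^sub>R X i \<omega>) /\<^sub>R \<Lambda> t \<omega> - \<mu>)
             \<le> num t \<omega> / (6 * \<Lambda> t \<omega>) + (\<beta> / 2 + ln (1 / \<alpha>)) / \<Lambda> t \<omega>}"
  have [measurable]: "num t \<in> borel_measurable M" for t
    unfolding num_def s_fun_def
  proof (intro borel_measurable_sum)
    fix i assume "i \<in> {1..t}"
    note [measurable] = X_M[OF this]
    show "(\<lambda>\<omega>. (lam i \<omega>)\<^sup>2 * ((1 + 1 / \<beta>) * (norm (X i \<omega>) + v)\<^sup>2 + 2 * w_fun \<beta> (\<Sigma> i \<omega>)))
        \<in> borel_measurable M"
      by measurable
  qed
  have [measurable]: "\<Lambda> t \<in> borel_measurable M" for t
    unfolding \<Lambda>_def using X_M by (intro borel_measurable_sum)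
  have [measurable]: "(\<lambda>\<omega>. \<Sum>i=1..t. lam i \<omega> *\<^sub>R X i \<omega>) \<in> borel_measurable M" for t
    using X_M by (intro borel_measurable_sum borel_measurable_scaleR)
  have good_M: "good \<in> sets M"
    unfolding good_def by measurable
  have "space M - bad \<subseteq> good"
  proof
    fix \<omega> assume \<omega>: "\<omega> \<in> space M - bad"
    have "norm ((\<Sum>i=1..t. lam i \<omega> *\<^sub>R X i \<omega>) /\<^sub>R \<Lambda> t \<omega> - \<mu>)
        \<le> num t \<omega> / (6 * \<Lambda> t \<omega>) + (\<beta> / 2 + ln (1 / \<alpha>)) / \<Lambda> t \<omega>" if "t \<ge> 1" for t
    proof -
      have pos: "\<Lambda> t \<omega> > 0"
        unfolding \<Lambda>_def using \<omega> that assms(9) by (intro sum_pos) auto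
      have "G t \<omega> < ennreal (1 / \<alpha>)"
        using \<omega> by (auto simp: bad_def not_le)
      then have "norm (\<Sum>i\<in>{1..t}. lam i \<omega> *\<^sub>R (X i \<omega> - \<mu>)) \<le>
          (\<Sum>i\<in>{1..t}. (lam i \<omega>)\<^sup>2 * ((1 + 1 / \<beta>) * (norm (X i \<omega> - \<mu>))\<^sup>2 + 2 * w_fun \<beta> (\<Sigma> i \<omega>))) / 6
          + \<beta> / 2 + ln (1 / \<alpha>)"
        using \<open>\<beta> > 0\<close> \<open>0 < \<alpha>\<close>
        by (intro gauss_mixture_imp_norm_bound) (auto simp: G_def f_def P_def)
      also have "\<dots> \<le> num t \<omega> / 6 + \<beta> / 2 + ln (1 / \<alpha>)"
      proof -
        \<comment> \<open>Replaces the centred observation by the observable quantity in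
          \<open>s_fun\<close>.\<close>
        have "norm (X i \<omega> - \<mu>) \<le> norm (X i \<omega>) + v" for i
          using norm_triangle_ineq4[of "X i \<omega>" \<mu>] norm_\<mu> by linarith
        then show ?thesis
          unfolding num_def s_fun_def using \<open>\<beta> > 0\<close>
          by (intro add_right_mono divide_right_mono sum_mono mult_left_mono power_mono) auto
      qed
      finally have le: "norm (\<Sum>i\<in>{1..t}. lam i \<omega> *\<^sub>R (X i \<omega> - \<mu>)) \<le> num t \<omega> / 6 + \<beta> / 2 + ln (1 / \<alpha>)" .
      \<comment> \<open>The weights add up to \<Lambda>, so centring the weighted average is the
        same as centring each observation.\<close>
      have "(\<Sum>i=1..t. lam i \<omega> *\<^sub>R X i \<omega>) /\<^sub>R \<Lambda> t \<omega> - \<mu> =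
          (\<Sum>i\<in>{1..t}. lam i \<omega> *\<^sub>R (X i \<omega> - \<mu>)) /\<^sub>R \<Lambda> t \<omega>"
      proof -
        have "(\<Sum>i\<in>{1..t}. lam i \<omega> *\<^sub>R (X i \<omega> - \<mu>)) =
            (\<Sum>i=1..t. lam i \<omega> *\<^sub>R X i \<omega>) - \<Lambda> t \<omega> *\<^sub>R \<mu>"
          by (simp add: scaleR_diff_right sum_subtractf scaleR_sum_left \<Lambda>_def)
        then show ?thesis
          using pos by (simp add: scaleR_diff_right)
      qed
      then have "norm ((\<Sum>i=1..t. lam i \<omega> *\<^sub>R X i \<omega>) /\<^sub>R \<Lambda> t \<omega> - \<mu>) =
          norm (\<Sum>i\<in>{1..t}. lam i \<omega> *\<^sub>R (X i \<omega> - \<mu>)) / \<Lambda> t \<omega>"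
        using pos by (simp add: divide_inverse mult.commute)
      also have "\<dots> \<le> (num t \<omega> / 6 + \<beta> / 2 + ln (1 / \<alpha>)) / \<Lambda> t \<omega>"
        using pos le by (intro divide_right_mono) auto
      finally show ?thesis
        by (simp add: add_divide_distrib)
    qed
    then show "\<omega> \<in> good"
      using \<omega> by (simp add: good_def)
  qed
  then have "prob (space M - bad) \<le> prob good"
    using good_M by (rule finite_measure_mono)
  moreover have "prob (space M - bad) = 1 - prob bad"
    by (rule prob_compl[OF bad_M])
  ultimately have "1 - \<alpha> \<le> prob good"
    using prob_bad by linarith
  then show ?thesis
    unfolding good_def num_def \<Lambda>_def Ball_def atLeast_iff .
qed

end
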